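(* Let $X$ be a finite simplicial complex on vertex set $V$. Then $$\sum_{r\in J_X} r\binom{\eta(X)}{r}\ \ge\ \Gamma(X).$$
   Context: A finite simplicial complex $X$ on a finite vertex set $V$ is a downward closed family of subsets of $V$ containing $\emptyset$ and every singleton $\{v\}$, $v\in V$; $\dim\sigma=|\sigma|-1$. A set $\sigma\subset V$ is a missing face of $X$ if $\sigma\notin X$ but every proper subset of $\sigma$ belongs to $X$. For vertices $v,w$ and a set $\sigma$, write $vw\sigma=\{v,w\}\cup\sigma$. Connectivity: $\eta(X)=\operatorname{conn}_{\mathbb R}(X)+2$, where $\operatorname{conn}_{\mathbb R}(X)=\min\{i:\tilde H^i(X;\mathbb R)\ne0\}-1$ and $\tilde H^i$ is reduced simplicial cohomology. If all reduced cohomology of $X$ vanishes, then $\eta(X)=+\infty$ and the left-hand side of the inequality is read as $+\infty$. Vector domination number: let $\mathcal M_i(X)$ be the set of missing faces of $X$ of dimension $i$, $J_X=\{i:\mathcal M_i(X)\ne\emptyset\}$, and $S(X)=\bigcup_{i\in J_X}\binom{V}{i-1}$, where $\binom{V}{j}$ is the set of $j$-element subsets of $V$. For $\sigma\in S(X)$, a vector representation of $X$ with respect to $\sigma$ is a map $P_\sigma:V\to\mathbb R^{\ell}$ (for some $\ell=\ell(\sigma)\in\mathbb N$) such that $P_\sigma(v)\cdot P_\sigma(w)\ge 1$ if $vw\sigma\in\mathcal M_{|\sigma|+1}(X)$ and $P_\sigma(v)\cdot P_\sigma(w)\ge 0$ otherwise ($v,w\in V$). Identify $P_\sigma$ with the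 $|V|\times\ell$ matrix whose rows are the vectors $P_\sigma(v)$. A vector representation of $X$ is a collection $P=\{P_\sigma:\sigma\in S(X)\}$ of such maps. A family of non-negative (row) vectors $\{\alpha_\sigma\in\mathbb R^V:\sigma\in S(X)\}$ is dominating for $P$ if $\sum_{\sigma\in S(X)}\alpha_\sigma P_\sigma P_\sigma^T\ge\mathbf 1$ coordinatewise, where $\mathbf 1$ is the all-ones vector. The value of $P$ is $|P|=\min\{\sum_{\sigma\in S(X)}\alpha_\sigma\cdot\mathbf 1:\{\alpha_\sigma\}\text{ dominating for }P\}$ (read as $+\infty$ if there is no dominating family). $\Gamma(X)$ is the supremum of $|P|$ over all vector representations $P$ of $X$. *)

theory Defs
  imports
    "HOL-Combinatorics.Permutations"
    "HOL-Library.Extended_Real"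
    "Jordan_Normal_Form.Matrix"
begin

section \<open>Simplicial complexes and missing faces\<close>

definition finite_simplicial_complex :: "'a set \<Rightarrow> 'a set set \<Rightarrow> bool" where
  "finite_simplicial_complex V X \<longleftrightarrow>
     finite V \<and> X \<subseteq> Pow V \<and> {} \<in> X \<and> (\<forall>v\<in>V. {v} \<in> X) \<and>
     (\<forall>\<sigma>\<in>X. \<forall>\<tau>. \<tau> \<subseteq> \<sigma> \<longrightarrow> \<tau> \<in> X)"

definition sdim :: "'a set \<Rightarrow> int" where
  "sdim \<sigma> = int (card \<sigma>) - 1"

definition missing_face :: "'a set \<Rightarrow> 'a set set \<Rightarrow> 'a set \<Rightarrow> bool" where
  "missing_face V X \<sigma> \<longleftrightarrow> \<sigma> \<subseteq> V \<and> \<sigma> \<notin> X \<and> (\<forall>\<tau>. \<tau> \<subset> \<sigma> \<longrightarrow> \<tau> \<in> X)"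

text \<open>
  Indexing by natural numbers loses nothing: the empty set and the singletons belong to a
  simplicial complex, so every missing face has dimension at least one.
\<close>

definition missing_faces :: "'a set \<Rightarrow> 'a set set \<Rightarrow> nat \<Rightarrow> 'a set set" where
  "missing_faces V X i = {\<sigma>. missing_face V X \<sigma> \<and> sdim \<sigma> = int i}"

definition missing_dims :: "'a set \<Rightarrow> 'a set set \<Rightarrow> nat set" where
  "missing_dims V X = {i. missing_faces V X i \<noteq> {}}"

definition index_simplices :: "'a set \<Rightarrow> 'a set set \<Rightarrow> 'a set set" where
  "index_simplices V X = (\<Union>i\<in>missing_dims V X. {\<sigma>. \<sigma> \<subseteq> V \<and> card \<sigma> = i - 1})"


section \<open>Reduced simplicial cohomology with real coefficients\<close>

text \<open>
  Cochains are alternating real functions on ordered simplices, extended by 0 to all other lists.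
  The empty list is the ordered simplex of dimension -1, so that the cochain complex is the
  augmented one and its cohomology is reduced. In degrees below -1 the only cochain is 0.
\<close>

definition ordered_simplices :: "'a set set \<Rightarrow> int \<Rightarrow> 'a list set" where
  "ordered_simplices X k = {xs. distinct xs \<and> set xs \<in> X \<and> sdim (set xs) = k}"

definition cochains :: "'a set set \<Rightarrow> int \<Rightarrow> ('a list \<Rightarrow> real) set" where
  "cochains X k =
     {\<phi>. (\<forall>xs. xs \<notin> ordered_simplices X k \<longrightarrow> \<phi> xs = 0) \<and>
         (\<forall>xs\<in>ordered_simplices X k. \<forall>p. p permutes {..<length xs} \<longrightarrow>
            \<phi> (permute_list p xs) = of_int (sign p) * \<phi> xs)}"

definition coboundary :: "'a set set \<Rightarrow> int \<Rightarrow> ('a list \<Rightarrow> real) \<Rightarrow> 'a list \<Rightarrow> real" where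
  "coboundary X k \<phi> = (\<lambda>xs.
     if xs \<in> ordered_simplices X (k + 1)
     then \<Sum>i<length xs. (-1) ^ i * \<phi> (take i xs @ drop (Suc i) xs)
     else 0)"

definition cocycles :: "'a set set \<Rightarrow> int \<Rightarrow> ('a list \<Rightarrow> real) set" where
  "cocycles X k = {\<phi> \<in> cochains X k. coboundary X k \<phi> = (\<lambda>_. 0)}"

definition coboundaries :: "'a set set \<Rightarrow> int \<Rightarrow> ('a list \<Rightarrow> real) set" where
  "coboundaries X k = coboundary X (k - 1) ` cochains X (k - 1)"

definition reduced_cohomology :: "'a set set \<Rightarrow> int \<Rightarrow> ('a list \<Rightarrow> real) set set" where
  "reduced_cohomology X k =
     cocycles X k // {(\<phi>, \<psi>). \<phi> \<in> cocycles X k \<and> \<psi> \<in> cocycles X k \<and>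
                              (\<lambda>xs. \<phi> xs - \<psi> xs) \<in> coboundaries X k}"

text \<open>
  The zero element of the quotient is the coset of the coboundaries. An infimum over the empty
  set is \<open>\<infinity>\<close>, so that \<open>conn_real\<close> and \<open>conn_eta\<close> are \<open>\<infinity>\<close> if all reduced cohomology
  vanishes; otherwise \<open>conn_eta\<close> is a natural number, on which \<open>gchoose\<close> is the usual binomial
  coefficient.
\<close>

definition conn_real :: "'a set set \<Rightarrow> ereal" where
  "conn_real X = (INF i\<in>{i. reduced_cohomology X i \<noteq> {coboundaries X i}}. ereal (of_int i)) - 1"

definition conn_eta :: "'a set set \<Rightarrow> ereal" where
  "conn_eta X = conn_real X + 2"


section \<open>Vector domination\<close>

definition vector_representation_at ::
    "'a set \<Rightarrow> 'a set set \<Rightarrow> 'a set \<Rightarrow> ('a \<Rightarrow> real vec) \<Rightarrow> bool" where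
  "vector_representation_at V X \<sigma> p \<longleftrightarrow>
     (\<exists>l. \<forall>v\<in>V. p v \<in> carrier_vec l) \<and>
     (\<forall>v\<in>V. \<forall>w\<in>V.
        if {v, w} \<union> \<sigma> \<in> missing_faces V X (card \<sigma> + 1)
        then p v \<bullet> p w \<ge> 1
        else p v \<bullet> p w \<ge> 0)"

definition vector_representation ::
    "'a set \<Rightarrow> 'a set set \<Rightarrow> ('a set \<Rightarrow> 'a \<Rightarrow> real vec) \<Rightarrow> bool" where
  "vector_representation V X P \<longleftrightarrow>
     (\<forall>\<sigma>\<in>index_simplices V X. vector_representation_at V X \<sigma> (P \<sigma>))"

text \<open>
  The inner sum is the \<open>w\<close>-coordinate of \<open>\<alpha>\<^sub>\<sigma> P\<^sub>\<sigma> P\<^sub>\<sigma>\<^sup>T\<close>, since the \<open>(v, w)\<close>-entry of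
  \<open>P\<^sub>\<sigma> P\<^sub>\<sigma>\<^sup>T\<close> is the scalar product of the rows \<open>P\<^sub>\<sigma>(v)\<close> and \<open>P\<^sub>\<sigma>(w)\<close>.
\<close>

definition dominating ::
    "'a set \<Rightarrow> 'a set set \<Rightarrow> ('a set \<Rightarrow> 'a \<Rightarrow> real vec) \<Rightarrow> ('a set \<Rightarrow> 'a \<Rightarrow> real) \<Rightarrow> bool" where
  "dominating V X P \<alpha> \<longleftrightarrow>
     (\<forall>\<sigma>\<in>index_simplices V X. \<forall>v\<in>V. \<alpha> \<sigma> v \<ge> 0) \<and>
     (\<forall>w\<in>V. (\<Sum>\<sigma>\<in>index_simplices V X. \<Sum>v\<in>V. \<alpha> \<sigma> v * (P \<sigma> v \<bullet> P \<sigma> w)) \<ge> 1)"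

text \<open>
  The infimum is a minimum whenever a dominating family exists, because it is the value of a
  feasible linear program whose objective is bounded below; otherwise it is \<open>\<infinity>\<close>.
\<close>

definition rep_value :: "'a set \<Rightarrow> 'a set set \<Rightarrow> ('a set \<Rightarrow> 'a \<Rightarrow> real vec) \<Rightarrow> ereal" where
  "rep_value V X P =
     (INF \<alpha>\<in>{\<alpha>. dominating V X P \<alpha>}. ereal (\<Sum>\<sigma>\<in>index_simplices V X. \<Sum>v\<in>V. \<alpha> \<sigma> v))"

definition domination_Gamma :: "'a set \<Rightarrow> 'a set set \<Rightarrow> ereal" where
  "domination_Gamma V X = (SUP P\<in>{P. vector_representation V X P}. rep_value V X P)"

end

theory Submission
  imports Defs
begin

text \<open>
  Let \<open>m = \<eta>(X)\<close> be finite, so that \<open>X\<close> has a nontrivial cohomology class whose simplices have \<open>m\<close>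
  vertices. By linear programming duality (\<open>linear_program_duality\<close>), the inequality for a vector
  representation \<open>P\<close> says that a weight \<open>\<beta> \<ge> 0\<close> on the vertices with
  \<open>P\<^sub>\<sigma> P\<^sub>\<sigma>\<^sup>T \<beta> \<le> s\<close> for all \<open>\<sigma>\<close> has total weight at most \<open>s \<Sum> r (m choose r)\<close>. The
  scale \<open>s\<close> is kept because an infeasible program has the certificate \<open>s = 0\<close>. By a
  perturbation, one may assume that \<open>\<beta>\<close> is positive. The bound on the total weight is then proved
  by the spectral method of Aharoni, Berger and Meshulam.

  Give a simplex the product of the weights of its vertices, and let \<open>f\<close> be a harmonic
  representative of the class: a nonzero cocycle orthogonal to all coboundaries
  (\<open>harmonic_representative\<close>). Let \<open>d\<close> and \<open>d\<^sup>*\<close> be the coboundary of the full simplex on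
  \<open>V\<close> and its weighted adjoint, the contraction with \<open>\<beta>\<close>. Their Laplacian \<open>d\<^sup>* d + d d\<^sup>*\<close> is
  multiplication by the total weight (\<open>contraction_full_coboundary\<close>). As \<open>f\<close> is harmonic in \<open>X\<close>,
  the term \<open>\<langle>f, d d\<^sup>* f\<rangle>\<close> vanishes, and \<open>\<langle>f, d\<^sup>* d f\<rangle>\<close> only sees the nonfaces \<open>\<tau>\<close> with
  \<open>m + 1\<close> vertices; thus the total weight times \<open>\<parallel>f\<parallel>\<^sup>2\<close> is what these nonfaces contribute.

  A vertex \<open>u\<close> of \<open>\<tau>\<close> for which \<open>\<tau> - u\<close> is a face lies in every missing face inside \<open>\<tau>\<close>.
  Hence the nonfaces contribute at most a weighted sum of terms \<open>(f(u\<rho>) - f(v\<rho>))\<^sup>2\<close>, where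
  \<open>\<tau> = uv\<rho>\<close> and \<open>u\<close>, \<open>v\<close> lie in a common missing face \<open>uv\<sigma>\<close> with \<open>\<sigma> \<subseteq> \<rho>\<close>
  (\<open>cocycle_coboundary_bound\<close>). For fixed \<open>\<rho>\<close> and \<open>\<sigma>\<close>, replacing the indicator of these pairs
  by the Gram matrix \<open>P\<^sub>\<sigma>(u) \<bullet> P\<^sub>\<sigma>(v)\<close> can only increase the sum; expanding the squares, the row
  bounds control the diagonal part, and the mixed part has a favourable sign because the Gram matrix
  is positive semidefinite (\<open>laplacian_form_le\<close>). There are \<open>(m - 1) choose (r - 1)\<close> sets
  \<open>\<sigma> \<subseteq> \<rho>\<close> of size \<open>r - 1\<close>, every face occurs as \<open>u\<rho>\<close> in \<open>m\<close> ways, and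
  \<open>m ((m - 1) choose (r - 1)) = r (m choose r)\<close>.
\<close>

section \<open>Linear programming duality\<close>

lemma real_between_finite_sets:
  fixes A B :: "real set"
  assumes "finite A" "finite B" "\<And>a b. a \<in> A \<Longrightarrow> b \<in> B \<Longrightarrow> a \<le> b"
  shows "\<exists>t. (\<forall>a\<in>A. a \<le> t) \<and> (\<forall>b\<in>B. t \<le> b)"
proof (cases "A = {}")
  case True
  show ?thesis
  proof (cases "B = {}")
    case False
    then show ?thesis using True assms(2) by (intro exI[of _ "Min B"]) auto
  qed (use True in auto)
next
  case False
  then show ?thesis using assms by (intro exI[of _ "Max A"]) auto
qed

text \<open>
  A pair \<open>(a, b)\<close> stands for the inequality \<open>b \<le> a \<bullet> x\<close>, and \<open>K\<close> for any set of inequalities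
  that contains all nonnegative combinations of those in \<open>C\<close>. A variable \<open>k\<close> is eliminated by
  comparing every lower bound on \<open>x k\<close> with every upper bound. Leaving \<open>K\<close> abstract lets the induction pass to
  the subset of \<open>K\<close> in which \<open>k\<close> does not occur.
\<close>

lemma fourier_motzkin:
  fixes K :: "(('j \<Rightarrow> real) \<times> real) set"
  assumes "finite J" "finite C" "C \<subseteq> K"
    and "\<And>a b a' b'. (a, b) \<in> K \<Longrightarrow> (a', b') \<in> K \<Longrightarrow> (\<lambda>j. a j + a' j, b + b') \<in> K"
    and "\<And>a b t. (a, b) \<in> K \<Longrightarrow> t \<ge> 0 \<Longrightarrow> (\<lambda>j. t * a j, t * b) \<in> K"
    and "\<not> (\<exists>x. \<forall>(a, b)\<in>C. b \<le> (\<Sum>j\<in>J. a j * x j))"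
  shows "\<exists>(a, b)\<in>K. (\<forall>j\<in>J. a j = 0) \<and> b > 0"
  using assms
proof (induction J arbitrary: C K rule: finite_induct)
  case empty
  then show ?case by (force simp: not_le)
next
  case (insert k J)
  note add = insert.prems(3) and scale = insert.prems(4)
  define combine where "combine = (\<lambda>((a::'j \<Rightarrow> real, b::real), (a'::'j \<Rightarrow> real, b'::real)).
      (\<lambda>j. (1 / a k) * a j + (1 / - a' k) * a' j, (1 / a k) * b + (1 / - a' k) * b'))"
  define Cp where "Cp = {c \<in> C. fst c k > 0}"
  define Cn where "Cn = {c \<in> C. fst c k < 0}"
  define C' where "C' = {c \<in> C. fst c k = 0} \<union> combine ` (Cp \<times> Cn)"
  define K' where "K' = {c \<in> K. fst c k = 0}"
  have fin: "finite C'"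
    using insert.prems(1) by (auto simp: C'_def Cp_def Cn_def)
  have sub: "C' \<subseteq> K'"
  proof -
    have "combine (c, c') \<in> K'" if "c \<in> Cp" "c' \<in> Cn" for c c'
    proof -
      obtain a b a' b' where c: "c = (a, b)" "c' = (a', b')" by (metis surj_pair)
      have "(a, b) \<in> K" "(a', b') \<in> K" "a k > 0" "a' k < 0"
        using that insert.prems(2) c by (auto simp: Cp_def Cn_def)
      then have "combine (c, c') \<in> K"
        unfolding combine_def c prod.case by (intro add scale) auto
      then show ?thesis
        using \<open>a k > 0\<close> \<open>a' k < 0\<close> by (simp add: K'_def combine_def c)
    qed
    then show ?thesis using insert.prems(2) by (auto simp: C'_def K'_def)
  qed
  have inf: "\<not> (\<exists>x. \<forall>(a, b)\<in>C'. b \<le> (\<Sum>j\<in>J. a j * x j))"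
  proof
    assume "\<exists>x. \<forall>(a, b)\<in>C'. b \<le> (\<Sum>j\<in>J. a j * x j)"
    then obtain x where x: "\<And>a b. (a, b) \<in> C' \<Longrightarrow> b \<le> (\<Sum>j\<in>J. a j * x j)" by blast
    define bd where "bd = (\<lambda>(a::'j \<Rightarrow> real, b). (b - (\<Sum>j\<in>J. a j * x j)) / a k)"
    have "\<exists>t. (\<forall>l\<in>bd ` Cp. l \<le> t) \<and> (\<forall>u\<in>bd ` Cn. t \<le> u)"
    proof (rule real_between_finite_sets)
      show "finite (bd ` Cp)" "finite (bd ` Cn)"
        using insert.prems(1) by (auto simp: Cp_def Cn_def)
      fix l u assume "l \<in> bd ` Cp" "u \<in> bd ` Cn"
      then obtain a b a' b' where ab: "(a, b) \<in> Cp" "(a', b') \<in> Cn" "l = bd (a, b)" "u = bd (a', b')"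
        by auto
      then have "combine ((a, b), (a', b')) \<in> C'" by (auto simp: C'_def)
      from x[OF this[unfolded combine_def prod.case]]
      have "(1 / a k) * b + (1 / - a' k) * b'
          \<le> (\<Sum>j\<in>J. ((1 / a k) * a j + (1 / - a' k) * a' j) * x j)" .
      also have "\<dots> = (1 / a k) * (\<Sum>j\<in>J. a j * x j) + (1 / - a' k) * (\<Sum>j\<in>J. a' j * x j)"
        by (simp only: sum_distrib_left sum.distrib[symmetric] distrib_right mult.assoc)
      finally show "l \<le> u"
        by (simp add: ab bd_def diff_divide_distrib)
    qed
    then obtain t where t: "\<And>c. c \<in> Cp \<Longrightarrow> bd c \<le> t" "\<And>c. c \<in> Cn \<Longrightarrow> t \<le> bd c" by blast
    have "b \<le> (\<Sum>j\<in>insert k J. a j * (x(k := t)) j)" if "(a, b) \<in> C" for a b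
    proof -
      have "(\<Sum>j\<in>J. a j * (x(k := t)) j) = (\<Sum>j\<in>J. a j * x j)"
        using insert.hyps by (intro sum.cong) auto
      then have eq: "(\<Sum>j\<in>insert k J. a j * (x(k := t)) j) = a k * t + (\<Sum>j\<in>J. a j * x j)"
        using insert.hyps by simp
      consider "a k > 0" | "a k < 0" | "a k = 0" by linarith
      then show ?thesis
      proof cases
        case 1
        then show ?thesis using t(1)[of "(a, b)"] that
          unfolding eq by (simp add: Cp_def bd_def field_simps)
      next
        case 2
        then show ?thesis using t(2)[of "(a, b)"] that
          unfolding eq by (simp add: Cn_def bd_def field_simps)
      next
        case 3
        then show ?thesis using x[of a b] that unfolding eq by (simp add: C'_def)
      qed
    qed
    then show False using insert.prems(5) by blast
  qed
  have "\<exists>(a, b)\<in>K'. (\<forall>j\<in>J. a j = 0) \<and> b > 0"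
    by (rule insert.IH[OF fin sub _ _ inf]) (auto simp: K'_def intro: add scale)
  then show ?case by (auto simp: K'_def)
qed

text \<open>
  The hypothesis is homogeneous in \<open>(y, s)\<close>: for \<open>s > 0\<close> it bounds the dual program, and for
  \<open>s = 0\<close> it excludes a direction in which the dual is unbounded. It therefore yields feasibility of
  the primal program as well as the bound on its value.
\<close>

lemma linear_program_duality:
  fixes M :: "'i \<Rightarrow> 'w \<Rightarrow> real"
  assumes fin: "finite I" "finite W"
    and dual: "\<And>y s. (\<And>w. w \<in> W \<Longrightarrow> y w \<ge> 0) \<Longrightarrow> s \<ge> 0 \<Longrightarrow>
        (\<And>i. i \<in> I \<Longrightarrow> (\<Sum>w\<in>W. y w * M i w) \<le> s) \<Longrightarrow> sum y W \<le> s * c"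
  shows "\<exists>x. (\<forall>i\<in>I. x i \<ge> 0) \<and> (\<forall>w\<in>W. (\<Sum>i\<in>I. x i * M i w) \<ge> 1) \<and> sum x I \<le> c"
proof (rule ccontr)
  assume infeasible: "\<not> ?thesis"
  define C where "C = (\<lambda>w. (\<lambda>i. M i w, 1)) ` W \<union> (\<lambda>k. (\<lambda>i. if i = k then 1 else 0, 0)) ` I
      \<union> {(\<lambda>i. -1, - c)}"
  \<comment> \<open>Slack in the first component accounts for multiples of the inequalities \<open>x i \<ge> 0\<close>.\<close>
  define K where "K = {(a, b). \<exists>y s. (\<forall>w\<in>W. y w \<ge> 0) \<and> s \<ge> 0 \<and>
      (\<forall>i\<in>I. (\<Sum>w\<in>W. y w * M i w) - s \<le> a i) \<and> b = sum y W - s * c}"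
  have "\<exists>(a, b)\<in>K. (\<forall>i\<in>I. a i = 0) \<and> b > 0"
  proof (rule fourier_motzkin)
    show "finite I" "finite C" using fin by (auto simp: C_def)
    show "C \<subseteq> K"
    proof -
      have "(\<lambda>i. M i w, 1) \<in> K" if "w \<in> W" for w
        using that fin unfolding K_def
        by (auto intro!: exI[of _ "\<lambda>w'. if w' = w then 1 else 0"] exI[of _ 0]
            simp: if_distrib[of "\<lambda>x. x * _"] cong: if_cong)
      moreover have "(\<lambda>i. if i = k then 1 else 0, 0) \<in> K" for k
        unfolding K_def by (auto intro!: exI[of _ "\<lambda>_. 0"] exI[of _ 0])
      moreover have "(\<lambda>i. -1, - c) \<in> K"
        unfolding K_def by (auto intro!: exI[of _ "\<lambda>_. 0"] exI[of _ 1])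
      ultimately show ?thesis by (auto simp: C_def)
    qed
    show "(\<lambda>i. a i + a' i, b + b') \<in> K" if "(a, b) \<in> K" "(a', b') \<in> K" for a b a' b'
    proof -
      from that obtain y s y' s' where
        ys: "\<forall>w\<in>W. y w \<ge> 0" "s \<ge> 0" "\<forall>i\<in>I. (\<Sum>w\<in>W. y w * M i w) - s \<le> a i" "b = sum y W - s * c"
          "\<forall>w\<in>W. y' w \<ge> 0" "s' \<ge> 0" "\<forall>i\<in>I. (\<Sum>w\<in>W. y' w * M i w) - s' \<le> a' i" "b' = sum y' W - s' * c"
        unfolding K_def by blast
      have "(\<Sum>w\<in>W. (y w + y' w) * M i w) - (s + s') \<le> a i + a' i" if "i \<in> I" for i
        using ys(3,7) that by (fastforce simp: distrib_right sum.distrib)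
      then show ?thesis using ys unfolding K_def
        by (auto intro!: exI[of _ "\<lambda>w. y w + y' w"] exI[of _ "s + s'"] simp: sum.distrib algebra_simps)
    qed
    show "(\<lambda>i. t * a i, t * b) \<in> K" if "(a, b) \<in> K" "t \<ge> 0" for a b t
    proof -
      from that obtain y s where
        ys: "\<forall>w\<in>W. y w \<ge> 0" "s \<ge> 0" "\<forall>i\<in>I. (\<Sum>w\<in>W. y w * M i w) - s \<le> a i" "b = sum y W - s * c"
        unfolding K_def by blast
      have "(\<Sum>w\<in>W. t * y w * M i w) - t * s \<le> t * a i" if "i \<in> I" for i
      proof -
        have "t * ((\<Sum>w\<in>W. y w * M i w) - s) \<le> t * a i"
          using ys(3) that \<open>t \<ge> 0\<close> by (intro mult_left_mono) auto
        then show ?thesis by (simp add: right_diff_distrib sum_distrib_left mult.assoc)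
      qed
      then show ?thesis using ys \<open>t \<ge> 0\<close> unfolding K_def
        by (auto intro!: exI[of _ "\<lambda>w. t * y w"] exI[of _ "t * s"]
            simp: sum_distrib_left right_diff_distrib)
    qed
    show "\<not> (\<exists>x. \<forall>(a, b)\<in>C. b \<le> (\<Sum>i\<in>I. a i * x i))"
    proof
      assume "\<exists>x. \<forall>(a, b)\<in>C. b \<le> (\<Sum>i\<in>I. a i * x i)"
      then obtain x where x: "\<And>a b. (a, b) \<in> C \<Longrightarrow> b \<le> (\<Sum>i\<in>I. a i * x i)" by blast
      have "1 \<le> (\<Sum>i\<in>I. x i * M i w)" if "w \<in> W" for w
        using x[of "\<lambda>i. M i w" 1] that by (auto simp: C_def mult.commute)
      moreover have "x k \<ge> 0" if "k \<in> I" for k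
        using x[of "\<lambda>i. if i = k then 1 else 0" 0] that fin
        by (auto simp: C_def if_distrib[of "\<lambda>x. x * _"] cong: if_cong)
      moreover have "sum x I \<le> c"
        using x[of "\<lambda>i. -1" "- c"] by (simp add: C_def sum_negf)
      ultimately show False using infeasible by blast
    qed
  qed
  then obtain y s where ys: "\<And>w. w \<in> W \<Longrightarrow> y w \<ge> 0" "s \<ge> 0"
      "\<And>i. i \<in> I \<Longrightarrow> (\<Sum>w\<in>W. y w * M i w) - s \<le> 0" "sum y W - s * c > 0"
    unfolding K_def by fastforce
  then show False using dual[of y s] by fastforce
qed

section \<open>Orthogonal projection onto a space of functions\<close>

text \<open>
  Removing a point \<open>s\<close> from the domain replaces \<open>W\<close> by the functions in \<open>W\<close> that vanish at \<open>s\<close>,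
  a subspace of codimension at most one; the missing direction is supplied by one Gram-Schmidt step.
\<close>

lemma orthogonal_projection:
  fixes W :: "('i \<Rightarrow> real) set" and w :: "'i \<Rightarrow> real"
  assumes "finite S" "\<And>x. x \<in> S \<Longrightarrow> w x > 0" "(\<lambda>_. 0) \<in> W"
    and "\<And>f g. f \<in> W \<Longrightarrow> g \<in> W \<Longrightarrow> (\<lambda>x. f x + g x) \<in> W"
    and "\<And>f c. f \<in> W \<Longrightarrow> (\<lambda>x. c * f x) \<in> W"
  shows "\<exists>p\<in>W. \<forall>g\<in>W. (\<Sum>x\<in>S. w x * (f x - p x) * g x) = 0"
  using assms
proof (induction S arbitrary: W f rule: finite_induct)
  case empty
  then show ?case by auto
next
  case (insert s S)
  note add = insert.prems(3) and scale = insert.prems(4)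
  have comb: "(\<lambda>x. g x + c * h x) \<in> W" if "g \<in> W" "h \<in> W" for g h c
    using add[OF that(1) scale[OF that(2)]] .
  define W0 where "W0 = {g \<in> W. g s = 0}"
  have IH: "\<exists>p\<in>W0. \<forall>g\<in>W0. (\<Sum>x\<in>S. w x * (f x - p x) * g x) = 0" for f
    by (rule insert.IH) (use insert.prems in \<open>auto simp: W0_def\<close>)
  define ip where "ip = (\<lambda>f g. \<Sum>x\<in>insert s S. w x * f x * g x)"
  have lin1: "ip (\<lambda>x. f x + c * g x) h = ip f h + c * ip g h" for f g h c
    by (simp add: ip_def sum.distrib sum_distrib_left algebra_simps del: sum.insert_if sum.insert)
  have lin2: "ip h (\<lambda>x. f x + c * g x) = ip h f + c * ip h g" for f g h c
    by (simp add: ip_def sum.distrib sum_distrib_left algebra_simps del: sum.insert_if sum.insert)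
  have proj: "\<exists>p\<in>W0. \<forall>g\<in>W0. ip (\<lambda>x. f x + (-1) * p x) g = 0" for f
  proof -
    obtain p where p: "p \<in> W0" "\<forall>g\<in>W0. (\<Sum>x\<in>S. w x * (f x - p x) * g x) = 0" using IH by blast
    moreover have "ip (\<lambda>x. f x + (-1) * p x) g = (\<Sum>x\<in>S. w x * (f x - p x) * g x)" if "g \<in> W0" for g
      using that insert.hyps by (simp add: ip_def W0_def)
    ultimately show ?thesis by auto
  qed
  have "\<exists>p\<in>W. \<forall>g\<in>W. ip (\<lambda>x. f x + (-1) * p x) g = 0"
  proof (cases "W0 = W")
    case True
    then show ?thesis using proj[of f] by simp
  next
    case False
    then obtain g where g: "g \<in> W" "g s \<noteq> 0" by (auto simp: W0_def)
    obtain q where q: "q \<in> W0" "\<And>g'. g' \<in> W0 \<Longrightarrow> ip (\<lambda>x. g x + (-1) * q x) g' = 0"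
      using proj by blast
    define h where "h = (\<lambda>x. g x + (-1) * q x)"
    have h: "h \<in> W" "h s \<noteq> 0" "\<And>g'. g' \<in> W0 \<Longrightarrow> ip h g' = 0"
      using comb[OF g(1), of q "-1"] g q by (auto simp: h_def W0_def)
    have "ip h h > 0"
    proof -
      have "w s * h s * h s \<le> ip h h"
        unfolding ip_def
        using insert.hyps insert.prems(1)
        by (intro member_le_sum[of s _ "\<lambda>x. w x * h x * h x"]) (auto simp: mult.assoc less_imp_le)
      moreover have "w s * h s * h s > 0"
        using h(2) insert.prems(1)[of s] by (auto simp: mult.assoc zero_less_mult_iff)
      ultimately show ?thesis by linarith
    qed
    obtain p0 where p0: "p0 \<in> W0" "\<And>g'. g' \<in> W0 \<Longrightarrow> ip (\<lambda>x. f x + (-1) * p0 x) g' = 0"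
      using proj by blast
    define r where "r = (\<lambda>x. f x + (-1) * p0 x)"
    define t where "t = ip r h / ip h h"
    define p where "p = (\<lambda>x. p0 x + t * h x)"
    have "p \<in> W" using comb[of p0 h t] p0 h by (simp add: p_def W0_def)
    moreover have "ip (\<lambda>x. f x + (-1) * p x) g' = 0" if "g' \<in> W" for g'
    proof -
      define g0 where "g0 = (\<lambda>x. g' x + (- (g' s / h s)) * h x)"
      have g0: "g0 \<in> W0" using comb[OF that h(1), of "- (g' s / h s)"] h(2) by (simp add: W0_def g0_def)
      have g': "g' = (\<lambda>x. g0 x + (g' s / h s) * h x)" by (simp add: g0_def)
      have "(\<lambda>x. f x + (-1) * p x) = (\<lambda>x. r x + (- t) * h x)"
        by (simp add: r_def p_def algebra_simps)
      then have "ip (\<lambda>x. f x + (-1) * p x) g' = ip r g' - t * ip h g'"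
        by (simp only: lin1)
      also have "ip r g' = (g' s / h s) * ip r h"
        by (subst g', subst lin2) (use p0 g0 r_def in auto)
      also have "ip h g' = (g' s / h s) * ip h h"
        by (subst g', subst lin2) (use h g0 in auto)
      finally show ?thesis using \<open>ip h h > 0\<close> by (simp add: t_def)
    qed
    ultimately show ?thesis by blast
  qed
  then show ?case by (simp add: ip_def del: sum.insert_if sum.insert)
qed

section \<open>Alternating functions on lists\<close>

text \<open>
  The condition ranges over all lists, not only over the simplices of a complex. An alternating function
  vanishes on lists with a repeated entry, so that cochains extended by zero satisfy it, and proofs by
  recursion on lists need no side conditions.
\<close>

definition alternating :: "('a list \<Rightarrow> real) \<Rightarrow> bool" where
  "alternating f \<longleftrightarrow> (\<forall>as x y bs. f (as @ x # y # bs) = - f (as @ y # x # bs))"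

lemma alternatingD: "alternating f \<Longrightarrow> f (as @ x # y # bs) = - f (as @ y # x # bs)"
  unfolding alternating_def by blast

lemma alternating_Cons: "alternating f \<Longrightarrow> alternating (\<lambda>xs. f (v # xs))"
  unfolding alternating_def by (metis append_Cons)

lemma alternating_swap:
  assumes "alternating f"
  shows "f (as @ x # bs @ y # cs) = - f (as @ y # bs @ x # cs)"
proof (induction bs arbitrary: as)
  case Nil
  then show ?case using alternatingD[OF assms, of as x y cs] by simp
next
  case (Cons b bs)
  have "f (as @ x # (b # bs) @ y # cs) = - f ((as @ [b]) @ x # bs @ y # cs)"
    using alternatingD[OF assms, of as x b] by simp
  also have "\<dots> = f (as @ b # y # bs @ x # cs)"
    by (subst Cons.IH) simp
  also have "\<dots> = - f (as @ y # (b # bs) @ x # cs)"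
    using alternatingD[OF assms, of as b y] by simp
  finally show ?case .
qed

lemma alternating_move_to_front:
  assumes "alternating f"
  shows "f (as @ x # bs) = (-1) ^ length as * f (x # as @ bs)"
proof (induction as arbitrary: bs rule: rev_induct)
  case (snoc a as)
  have "f ((as @ [a]) @ x # bs) = - f (as @ x # a # bs)"
    using alternatingD[OF assms, of as a x bs] by simp
  then show ?case using snoc[of "a # bs"] by simp
qed simp

lemma alternating_not_distinct:
  assumes "alternating f" "\<not> distinct xs"
  shows "f xs = 0"
proof -
  obtain as x bs cs where "xs = as @ [x] @ bs @ [x] @ cs"
    using not_distinct_decomp[OF assms(2)] by blast
  then show ?thesis using alternating_swap[OF assms(1), of as x bs x cs] by simp
qed

lemma list_decomp_two:
  assumes "i < j" "j < length xs"
  shows "take i xs @ xs ! i # take (j - Suc i) (drop (Suc i) xs) @ xs ! j # drop (Suc j) xs = xs"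
proof -
  have "Suc (i + (j - Suc i)) = j" "Suc (Suc (i + (j - Suc i))) = Suc j" "Suc i + Suc (j - Suc i) = Suc j" using assms by auto
  then have "take (j - Suc i) (drop (Suc i) xs) @ xs ! j # drop (Suc j) xs = drop (Suc i) xs"
    using id_take_nth_drop[of "j - Suc i" "drop (Suc i) xs", symmetric] assms
    by simp
  then show ?thesis
    using id_take_nth_drop[of i xs, symmetric] assms by simp
qed

lemma permute_list_transpose:
  assumes "i < j" "j < length xs"
  shows "permute_list (transpose i j) xs =
    take i xs @ xs ! j # take (j - Suc i) (drop (Suc i) xs) @ xs ! i # drop (Suc j) xs"
    (is "_ = ?r")
proof (rule nth_equalityI)
  show "length (permute_list (transpose i j) xs) = length ?r"
    using assms by simp
  fix n assume n: "n < length (permute_list (transpose i j) xs)"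
  have "permute_list (transpose i j) xs ! n = xs ! transpose i j n"
    using n by (simp add: permute_list_def)
  also have "\<dots> = ?r ! n"
  proof -
    consider "n < i" | "n = i" | "i < n" "n < j" | "n = j" | "j < n" by linarith
    then show ?thesis
      by cases (use assms n in \<open>auto simp: nth_append transpose_def nth_Cons split: nat.splits
          intro!: arg_cong[of _ _ "nth xs"]\<close>)
  qed
  finally show "permute_list (transpose i j) xs ! n = ?r ! n" .
qed

text \<open>
  Adjacent transpositions generate the transpositions, and these generate all permutations.
\<close>

lemma alternating_iff_permute_sign:
  fixes f :: "'a list \<Rightarrow> real"
  shows "alternating f \<longleftrightarrow>
    (\<forall>xs p. p permutes {..<length xs} \<longrightarrow> f (permute_list p xs) = of_int (sign p) * f xs)"
proof (intro iffI allI impI)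
  fix xs :: "'a list" and p assume f: "alternating f" and p: "p permutes {..<length xs}"
  define n where "n = length xs"
  have "\<forall>xs. length xs = n \<longrightarrow> f (permute_list p xs) = of_int (sign p) * f xs"
    using p[folded n_def] finite_lessThan
  proof (induction rule: permutes_induct)
    case id
    then show ?case by (simp add: sign_id)
  next
    case (swap a b p)
    show ?case
    proof (intro allI impI)
      fix xs :: "'a list" assume len: "length xs = n"
      have tr: "f (permute_list (transpose a b) xs) = - f xs"
      proof -
        have *: "f (permute_list (transpose a b) xs) = - f xs" if "a < b" "b < n" for a b
        proof -
          have "f (permute_list (transpose a b) xs) = - f (take a xs @ xs ! a
              # take (b - Suc a) (drop (Suc a) xs) @ xs ! b # drop (Suc b) xs)"
            using that len by (subst permute_list_transpose) (auto intro: alternating_swap[OF f])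
          then show ?thesis using list_decomp_two[OF that(1), of xs] that len by simp
        qed
        show ?thesis using *[of a b] *[of b a] swap.hyps
          by (cases "a < b") (auto simp: transpose_commute)
      qed
      have "permute_list (transpose a b \<circ> p) xs = permute_list p (permute_list (transpose a b) xs)"
        using swap.hyps len by (intro permute_list_compose) simp
      then have "f (permute_list (transpose a b \<circ> p) xs) = - (of_int (sign p) * f xs)"
        using swap.IH len tr by simp
      moreover have "sign (transpose a b \<circ> p) = - sign p"
        using swap.hyps permutation_permutes[of p]
        by (subst sign_compose) (auto simp: sign_swap_id permutation_swap_id)
      ultimately show "f (permute_list (transpose a b \<circ> p) xs) = of_int (sign (transpose a b \<circ> p)) * f xs"
        by simp
    qed
  qed
  then show "f (permute_list p xs) = of_int (sign p) * f xs" by (simp add: n_def)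
next
  assume R: "\<forall>xs p. p permutes {..<length xs} \<longrightarrow> f (permute_list p xs) = of_int (sign p) * f xs"
  show "alternating f"
    unfolding alternating_def
  proof (intro allI)
    fix as bs :: "'a list" and x y
    let ?p = "transpose (length as) (Suc (length as))" and ?xs = "as @ y # x # bs"
    have "?p permutes {..<length ?xs}" by (rule permutes_swap_id) auto
    then have "f (permute_list ?p ?xs) = of_int (sign ?p) * f ?xs" using R by blast
    moreover have "permute_list ?p ?xs = as @ x # y # bs"
      by (subst permute_list_transpose) (auto simp: nth_append)
    ultimately show "f (as @ x # y # bs) = - f (as @ y # x # bs)"
      by (simp add: sign_swap_id)
  qed
qed

section \<open>The coboundary of the full simplex\<close>

definition remove_nth :: "nat \<Rightarrow> 'a list \<Rightarrow> 'a list" where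
  "remove_nth i xs = take i xs @ drop (Suc i) xs"

lemma remove_nth_Cons [simp]:
  "remove_nth 0 (x # xs) = xs" "remove_nth (Suc i) (x # xs) = x # remove_nth i xs"
  by (simp_all add: remove_nth_def)

lemma length_remove_nth: "i < length xs \<Longrightarrow> length (remove_nth i xs) = length xs - 1"
  by (simp add: remove_nth_def)

lemma set_remove_nth_subset: "set (remove_nth i xs) \<subseteq> set xs"
  by (auto simp: remove_nth_def dest: in_set_takeD in_set_dropD)

lemma set_remove_nth: "distinct xs \<Longrightarrow> i < length xs \<Longrightarrow> set (remove_nth i xs) = set xs - {xs ! i}"
proof (induction xs arbitrary: i)
  case (Cons x xs)
  then show ?case by (cases i) auto
qed simp

lemma distinct_remove_nth: "distinct xs \<Longrightarrow> distinct (remove_nth i xs)"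
  by (auto simp: remove_nth_def intro: distinct_take distinct_drop
      dest: set_take_disj_set_drop_if_distinct[of xs i "Suc i"])

definition full_coboundary :: "('a list \<Rightarrow> real) \<Rightarrow> 'a list \<Rightarrow> real" where
  "full_coboundary f xs = (\<Sum>i<length xs. (-1) ^ i * f (remove_nth i xs))"

lemma full_coboundary_Nil [simp]: "full_coboundary f [] = 0"
  by (simp add: full_coboundary_def)

text \<open>
  Up to the first summand, the coboundary anticommutes with the insertion of a vertex \<open>v\<close> in front.
  Recursion on lists with this equation replaces the manipulation of alternating sums.
\<close>

lemma full_coboundary_Cons:
  "full_coboundary f (v # xs) = f xs - full_coboundary (\<lambda>ys. f (v # ys)) xs"
  by (simp add: full_coboundary_def sum.lessThan_Suc_shift sum_negf del: sum.lessThan_Suc)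

lemma full_coboundary_diff:
  "full_coboundary (\<lambda>xs. f xs - g xs) xs = full_coboundary f xs - full_coboundary g xs"
  by (simp add: full_coboundary_def right_diff_distrib sum_subtractf)

lemma full_coboundary_add:
  "full_coboundary (\<lambda>xs. f xs + g xs) xs = full_coboundary f xs + full_coboundary g xs"
  by (simp add: full_coboundary_def distrib_left sum.distrib)

lemma full_coboundary_scale:
  "full_coboundary (\<lambda>xs. c * f xs) xs = c * full_coboundary f xs"
  by (simp add: full_coboundary_def sum_distrib_left mult.left_commute)

lemma full_coboundary_sum:
  "full_coboundary (\<lambda>xs. \<Sum>v\<in>A. F v xs) xs = (\<Sum>v\<in>A. full_coboundary (F v) xs)"
  unfolding full_coboundary_def by (simp add: sum_distrib_left) (rule sum.swap)

lemma full_coboundary_zero: "full_coboundary (\<lambda>_. 0) xs = 0"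
  by (simp add: full_coboundary_def)

lemma full_coboundary_full_coboundary: "full_coboundary (full_coboundary f) xs = 0"
proof (induction xs arbitrary: f)
  case (Cons v xs)
  show ?case
    by (simp add: full_coboundary_Cons[of "full_coboundary f"] full_coboundary_Cons[of f]
        full_coboundary_diff Cons.IH)
qed simp

lemma alternating_full_coboundary:
  assumes "alternating f"
  shows "alternating (full_coboundary f)"
proof -
  have "full_coboundary f (as @ x # y # bs) = - full_coboundary f (as @ y # x # bs)" for as x y bs
    using assms
  proof (induction as arbitrary: f)
    case Nil
    have "(\<lambda>ys. f (x # y # ys)) = (\<lambda>ys. (-1) * f (y # x # ys))"
      using alternatingD[OF Nil, of "[]" x y] by simp
    then have "full_coboundary (\<lambda>ys. f (x # y # ys)) bs = - full_coboundary (\<lambda>ys. f (y # x # ys)) bs"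
      by (simp only: full_coboundary_scale)
    then show ?case by (simp add: full_coboundary_Cons)
  next
    case (Cons a as)
    show ?case
      using Cons.IH[OF alternating_Cons[OF Cons.prems, of a]] alternatingD[OF Cons.prems, of as x y bs]
      by (simp add: full_coboundary_Cons)
  qed
  then show ?thesis unfolding alternating_def by blast
qed

text \<open>
  On alternating functions, this is the adjoint of the coboundary up to a factor that depends only on
  the degree, for the inner product in which the weight of a tuple is the product of the
  \<open>\<beta>\<close>-values of its entries.
\<close>

definition contraction :: "'a set \<Rightarrow> ('a \<Rightarrow> real) \<Rightarrow> ('a list \<Rightarrow> real) \<Rightarrow> 'a list \<Rightarrow> real" where
  "contraction V \<beta> f xs = (\<Sum>v\<in>V. \<beta> v * f (v # xs))"

lemma alternating_contraction:
  assumes "alternating f"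
  shows "alternating (contraction V \<beta> f)"
proof -
  have "contraction V \<beta> f (as @ x # y # bs) = - contraction V \<beta> f (as @ y # x # bs)" for as x y bs
  proof -
    have "f (v # as @ x # y # bs) = - f (v # as @ y # x # bs)" for v
      using alternatingD[OF assms, of "v # as" x y bs] by simp
    then show ?thesis by (simp add: contraction_def sum_negf)
  qed
  then show ?thesis unfolding alternating_def by blast
qed

text \<open>
  The Laplacian of the full simplex is the scalar \<open>\<Sum>v\<in>V. \<beta> v\<close>. This is Cartan's homotopy formula,
  the \<open>\<beta>\<close>-weighted sum over \<open>v\<close> of \<open>full_coboundary_Cons\<close>.
\<close>

lemma contraction_full_coboundary:
  "contraction V \<beta> (full_coboundary f) xs =
    sum \<beta> V * f xs - full_coboundary (contraction V \<beta> f) xs"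
proof -
  have "contraction V \<beta> f = (\<lambda>ys. \<Sum>v\<in>V. \<beta> v * f (v # ys))"
    by (simp add: contraction_def fun_eq_iff)
  then have "full_coboundary (contraction V \<beta> f) xs =
      (\<Sum>v\<in>V. \<beta> v * full_coboundary (\<lambda>ys. f (v # ys)) xs)"
    by (simp add: full_coboundary_sum full_coboundary_scale)
  then show ?thesis
    by (simp add: contraction_def full_coboundary_Cons right_diff_distrib sum_subtractf sum_distrib_right)
qed

section \<open>Cochains of a complex\<close>

definition tuples :: "'a set \<Rightarrow> nat \<Rightarrow> 'a list set" where
  "tuples V m = {xs. set xs \<subseteq> V \<and> length xs = m}"

lemma finite_tuples: "finite V \<Longrightarrow> finite (tuples V m)"
  unfolding tuples_def by (rule finite_lists_length_eq)

lemma ordered_simplices_iff: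
  "xs \<in> ordered_simplices X (int m - 1) \<longleftrightarrow> distinct xs \<and> set xs \<in> X \<and> length xs = m"
  by (auto simp: ordered_simplices_def sdim_def distinct_card)

lemma ordered_simplices_negative: "k < -1 \<Longrightarrow> ordered_simplices X k = {}"
  by (auto simp: ordered_simplices_def sdim_def)

lemma ordered_simplices_subset_tuples:
  assumes "X \<subseteq> Pow V"
  shows "ordered_simplices X (int m - 1) \<subseteq> tuples V m"
  using assms by (auto simp: ordered_simplices_iff tuples_def)

lemma ordered_simplices_cong_mset:
  assumes "mset xs = mset ys"
  shows "xs \<in> ordered_simplices X k \<longleftrightarrow> ys \<in> ordered_simplices X k"
  using mset_eq_setD[OF assms] mset_eq_imp_distinct_iff[OF assms] by (simp add: ordered_simplices_def)

lemma cochains_iff: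
  "f \<in> cochains X k \<longleftrightarrow> alternating f \<and> (\<forall>xs. xs \<notin> ordered_simplices X k \<longrightarrow> f xs = 0)"
proof -
  have "f (permute_list p xs) = of_int (sign p) * f xs"
    if "xs \<notin> ordered_simplices X k" "\<forall>xs. xs \<notin> ordered_simplices X k \<longrightarrow> f xs = 0"
      "p permutes {..<length xs}" for xs p
    using that ordered_simplices_cong_mset[OF mset_permute_list[OF that(3)], of X k] by simp
  then show ?thesis
    unfolding cochains_def alternating_iff_permute_sign by blast
qed

lemma cochains_alternating: "f \<in> cochains X k \<Longrightarrow> alternating f"
  by (simp add: cochains_iff)

lemma cochains_restrict:
  assumes "alternating f"
  shows "(\<lambda>xs. if xs \<in> ordered_simplices X k then f xs else 0) \<in> cochains X k"
proof -
  have "(if as @ x # y # bs \<in> ordered_simplices X k then f (as @ x # y # bs) else 0) =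
      - (if as @ y # x # bs \<in> ordered_simplices X k then f (as @ y # x # bs) else 0)" for as x y bs
    using ordered_simplices_cong_mset[of "as @ x # y # bs" "as @ y # x # bs" X k]
      alternatingD[OF assms, of as x y bs] by simp
  then have "alternating (\<lambda>xs. if xs \<in> ordered_simplices X k then f xs else 0)"
    unfolding alternating_def by blast
  then show ?thesis by (simp add: cochains_iff)
qed

lemma zero_cochain: "(\<lambda>_. 0) \<in> cochains X k"
  by (simp add: cochains_def)

lemma cochains_lincomb:
  assumes "f \<in> cochains X k" "g \<in> cochains X k"
  shows "(\<lambda>xs. f xs + c * g xs) \<in> cochains X k"
  using assms by (simp add: cochains_def algebra_simps)

lemma coboundary_eq:
  "coboundary X k f xs = (if xs \<in> ordered_simplices X (k + 1) then full_coboundary f xs else 0)"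
  by (simp add: coboundary_def full_coboundary_def remove_nth_def)

lemma coboundary_lincomb:
  "coboundary X k (\<lambda>xs. f xs + c * g xs) = (\<lambda>xs. coboundary X k f xs + c * coboundary X k g xs)"
  by (simp add: fun_eq_iff coboundary_eq full_coboundary_add full_coboundary_scale)

lemma coboundary_cochain:
  assumes "f \<in> cochains X k"
  shows "coboundary X k f \<in> cochains X (k + 1)"
  unfolding coboundary_eq[abs_def]
  by (intro cochains_restrict alternating_full_coboundary cochains_alternating[OF assms])

lemma remove_nth_ordered_simplex:
  assumes "\<forall>\<sigma>\<in>X. \<forall>\<tau>. \<tau> \<subseteq> \<sigma> \<longrightarrow> \<tau> \<in> X" "xs \<in> ordered_simplices X (k + 1)" "i < length xs"
  shows "remove_nth i xs \<in> ordered_simplices X k"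
proof -
  have xs: "distinct xs" "set xs \<in> X" "int (length xs) = k + 2"
    using assms(2) by (auto simp: ordered_simplices_def sdim_def distinct_card)
  moreover have "set (remove_nth i xs) \<in> X"
    using assms(1) xs(2) set_remove_nth_subset by metis
  ultimately show ?thesis
    using assms(3) distinct_remove_nth[OF xs(1), of i] length_remove_nth[OF assms(3)]
    by (simp add: ordered_simplices_def sdim_def distinct_card of_nat_diff)
qed

lemma coboundary_coboundary:
  assumes "\<forall>\<sigma>\<in>X. \<forall>\<tau>. \<tau> \<subseteq> \<sigma> \<longrightarrow> \<tau> \<in> X"
  shows "coboundary X (k + 1) (coboundary X k f) = (\<lambda>_. 0)"
proof
  fix xs
  have "full_coboundary (coboundary X k f) xs = full_coboundary (full_coboundary f) xs"
    if "xs \<in> ordered_simplices X (k + 1 + 1)"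
    unfolding full_coboundary_def[of "coboundary X k f"] full_coboundary_def[of "full_coboundary f"]
    using remove_nth_ordered_simplex[OF assms that] by (simp add: coboundary_eq)
  then show "coboundary X (k + 1) (coboundary X k f) xs = 0"
    by (simp add: coboundary_eq full_coboundary_full_coboundary)
qed

lemma coboundaries_subset_cocycles:
  assumes "\<forall>\<sigma>\<in>X. \<forall>\<tau>. \<tau> \<subseteq> \<sigma> \<longrightarrow> \<tau> \<in> X"
  shows "coboundaries X k \<subseteq> cocycles X k"
  using coboundary_cochain[of _ X "k - 1"] coboundary_coboundary[OF assms, of "k - 1"]
  by (auto simp: coboundaries_def cocycles_def)

lemma zero_cocycle: "(\<lambda>_. 0) \<in> cocycles X k"
  by (auto simp: cocycles_def zero_cochain coboundary_eq fun_eq_iff full_coboundary_zero)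

lemma cocycles_lincomb:
  assumes "f \<in> cocycles X k" "g \<in> cocycles X k"
  shows "(\<lambda>xs. f xs + c * g xs) \<in> cocycles X k"
  using assms by (auto simp: cocycles_def cochains_lincomb coboundary_lincomb)

lemma coboundaries_lincomb:
  assumes "f \<in> coboundaries X k" "g \<in> coboundaries X k"
  shows "(\<lambda>xs. f xs + c * g xs) \<in> coboundaries X k"
proof -
  obtain f' g' where "f' \<in> cochains X (k - 1)" "f = coboundary X (k - 1) f'"
      "g' \<in> cochains X (k - 1)" "g = coboundary X (k - 1) g'"
    using assms by (auto simp: coboundaries_def)
  then show ?thesis
    unfolding coboundaries_def
    by (intro image_eqI[of _ _ "\<lambda>xs. f' xs + c * g' xs"]) (auto simp: coboundary_lincomb cochains_lincomb)
qed

lemma zero_coboundary: "(\<lambda>_. 0) \<in> coboundaries X k"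
  unfolding coboundaries_def
  by (rule image_eqI[of _ _ "\<lambda>_. 0"]) (auto simp: zero_cochain coboundary_eq fun_eq_iff full_coboundary_zero)

text \<open>
  If every cocycle is a coboundary, then the two spaces coincide, because coboundaries are cocycles, and
  the quotient consists of the single coset \<open>coboundaries X k\<close>.
\<close>

lemma nontrivial_cohomology_imp_cocycle:
  assumes X: "\<forall>\<sigma>\<in>X. \<forall>\<tau>. \<tau> \<subseteq> \<sigma> \<longrightarrow> \<tau> \<in> X" and "reduced_cohomology X k \<noteq> {coboundaries X k}"
  obtains f where "f \<in> cocycles X k" "f \<notin> coboundaries X k"
proof (rule ccontr)
  assume "\<not> thesis"
  then have eq: "cocycles X k = coboundaries X k"
    using that coboundaries_subset_cocycles[OF X, of k] by blast
  let ?R = "{(\<phi>, \<psi>). \<phi> \<in> cocycles X k \<and> \<psi> \<in> cocycles X k \<and> (\<lambda>xs. \<phi> xs - \<psi> xs) \<in> coboundaries X k}"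
  have "?R `` {f} = coboundaries X k" if "f \<in> cocycles X k" for f
    using that coboundaries_lincomb[of f X k _ "-1"] by (auto simp: eq)
  moreover have "cocycles X k \<noteq> {}" using zero_cocycle by blast
  ultimately have "reduced_cohomology X k = {coboundaries X k}"
    unfolding reduced_cohomology_def quotient_def by auto
  with assms(2) show False by simp
qed

lemma nontrivial_cohomology_degree:
  assumes X: "\<forall>\<sigma>\<in>X. \<forall>\<tau>. \<tau> \<subseteq> \<sigma> \<longrightarrow> \<tau> \<in> X" and "reduced_cohomology X k \<noteq> {coboundaries X k}"
  shows "k \<ge> -1"
proof (rule ccontr)
  assume "\<not> k \<ge> -1"
  then have none: "ordered_simplices X k = {}" by (simp add: ordered_simplices_negative)
  obtain f where f: "f \<in> cocycles X k" "f \<notin> coboundaries X k"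
    by (rule nontrivial_cohomology_imp_cocycle[OF assms])
  then have "f = (\<lambda>_. 0)" using none by (auto simp: cocycles_def cochains_iff)
  then show False using f(2) zero_coboundary by blast
qed

section \<open>Harmonic representatives\<close>

definition weight :: "('a \<Rightarrow> real) \<Rightarrow> 'a list \<Rightarrow> real" where
  "weight \<beta> xs = prod_list (map \<beta> xs)"

lemma weight_Cons [simp]: "weight \<beta> (x # xs) = \<beta> x * weight \<beta> xs"
  by (simp add: weight_def)

lemma weight_remove_nth: "i < length xs \<Longrightarrow> weight \<beta> xs = \<beta> (xs ! i) * weight \<beta> (remove_nth i xs)"
proof (induction xs arbitrary: i)
  case (Cons x xs)
  then show ?case by (cases i) auto
qed simp

lemma weight_pos: "(\<And>v. v \<in> set xs \<Longrightarrow> \<beta> v > 0) \<Longrightarrow> weight \<beta> xs > 0"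
  by (induction xs) (auto simp: weight_def)

text \<open>
  Subtracting from a cocycle its projection onto the coboundaries changes neither its class nor the fact
  that it is a cocycle.
\<close>

lemma harmonic_representative:
  assumes V: "finite V" "X \<subseteq> Pow V" and X: "\<forall>\<sigma>\<in>X. \<forall>\<tau>. \<tau> \<subseteq> \<sigma> \<longrightarrow> \<tau> \<in> X"
    and \<beta>: "\<And>v. v \<in> V \<Longrightarrow> \<beta> v > 0"
    and nontrivial: "reduced_cohomology X k \<noteq> {coboundaries X k}"
  obtains f where "f \<in> cocycles X k" "f \<noteq> (\<lambda>_. 0)"
    "\<forall>g\<in>coboundaries X k. (\<Sum>xs\<in>tuples V m. weight \<beta> xs * f xs * g xs) = 0"
proof -
  obtain h where h: "h \<in> cocycles X k" "h \<notin> coboundaries X k"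
    by (rule nontrivial_cohomology_imp_cocycle[OF X nontrivial])
  have pos: "weight \<beta> xs > 0" if "xs \<in> tuples V m" for xs
    using that \<beta> by (intro weight_pos) (auto simp: tuples_def)
  have "\<exists>p\<in>coboundaries X k. \<forall>g\<in>coboundaries X k.
      (\<Sum>xs\<in>tuples V m. weight \<beta> xs * (h xs - p xs) * g xs) = 0"
  proof (rule orthogonal_projection)
    show "(\<lambda>x. f x + g x) \<in> coboundaries X k" if "f \<in> coboundaries X k" "g \<in> coboundaries X k" for f g
      using coboundaries_lincomb[OF that, of 1] by simp
    show "(\<lambda>x. c * f x) \<in> coboundaries X k" if "f \<in> coboundaries X k" for f c
      using coboundaries_lincomb[OF zero_coboundary that, of c] by simp
  qed (use pos finite_tuples V zero_coboundary in auto)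
  then obtain p where p: "p \<in> coboundaries X k" "\<And>g. g \<in> coboundaries X k \<Longrightarrow>
      (\<Sum>xs\<in>tuples V m. weight \<beta> xs * (h xs - p xs) * g xs) = 0"
    by blast
  show thesis
  proof (rule that[of "\<lambda>xs. h xs - p xs"])
    show "(\<lambda>xs. h xs - p xs) \<in> cocycles X k"
      using cocycles_lincomb[OF h(1), of p "-1"] p(1) coboundaries_subset_cocycles[OF X] by auto
    show "(\<lambda>xs. h xs - p xs) \<noteq> (\<lambda>_. 0)"
    proof
      assume "(\<lambda>xs. h xs - p xs) = (\<lambda>_. 0)"
      then have "h = p" by (simp add: fun_eq_iff)
      then show False using h(2) p(1) by simp
    qed
  qed (use p in auto)
qed

section \<open>Sums over tuples\<close>

lemma sum_tuples_Suc:
  "(\<Sum>xs\<in>tuples V (Suc n). F xs) = (\<Sum>v\<in>V. \<Sum>ys\<in>tuples V n. F (v # ys))"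
proof -
  have "bij_betw (\<lambda>(v, ys). v # ys) (V \<times> tuples V n) (tuples V (Suc n))"
    by (rule bij_betw_byWitness[of _ "\<lambda>xs. (hd xs, tl xs)"])
       (auto simp: tuples_def length_Suc_conv)
  from sum.reindex_bij_betw[OF this, of F] show ?thesis
    by (simp add: sum.cartesian_product case_prod_unfold)
qed

lemma sum_tuples_remove_nth:
  assumes "i \<le> n"
  shows "(\<Sum>xs\<in>tuples V (Suc n). F (xs ! i) (remove_nth i xs)) = (\<Sum>v\<in>V. \<Sum>ys\<in>tuples V n. F v ys)"
  using assms
proof (induction i arbitrary: n F)
  case 0
  then show ?case by (simp add: sum_tuples_Suc)
next
  case (Suc i)
  then obtain n' where n: "n = Suc n'" "i \<le> n'" by (cases n) auto
  have "(\<Sum>xs\<in>tuples V (Suc n). F (xs ! Suc i) (remove_nth (Suc i) xs)) =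
      (\<Sum>a\<in>V. \<Sum>xs\<in>tuples V n. F (xs ! i) (a # remove_nth i xs))"
    by (simp add: sum_tuples_Suc[of _ _ n])
  also have "\<dots> = (\<Sum>a\<in>V. \<Sum>v\<in>V. \<Sum>ys\<in>tuples V n'. F v (a # ys))"
    using Suc.IH[OF n(2), of "\<lambda>v ys. F v (a # ys)" for a] by (simp add: n(1))
  also have "\<dots> = (\<Sum>v\<in>V. \<Sum>a\<in>V. \<Sum>ys\<in>tuples V n'. F v (a # ys))"
    by (rule sum.swap)
  also have "\<dots> = (\<Sum>v\<in>V. \<Sum>ys\<in>tuples V n. F v ys)"
    by (simp add: n(1) sum_tuples_Suc)
  finally show ?case .
qed

section \<open>Quadratic forms dominated by Gram matrices\<close>

lemma gram_matrix_nonneg: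
  fixes p :: "'a \<Rightarrow> real vec"
  assumes "\<And>v. v \<in> V \<Longrightarrow> p v \<in> carrier_vec l"
  shows "(\<Sum>u\<in>V. \<Sum>v\<in>V. x u * x v * (p u \<bullet> p v)) \<ge> 0"
proof -
  have "(\<Sum>u\<in>V. \<Sum>v\<in>V. x u * x v * (p u \<bullet> p v)) =
      (\<Sum>u\<in>V. \<Sum>v\<in>V. \<Sum>i<l. (x u * p u $ i) * (x v * p v $ i))"
    by (intro sum.cong refl)
       (auto simp: scalar_prod_def carrier_vecD[OF assms] sum_distrib_left lessThan_atLeast0 algebra_simps intro!: sum.cong)
  also have "\<dots> = (\<Sum>u\<in>V. \<Sum>i<l. \<Sum>v\<in>V. (x u * p u $ i) * (x v * p v $ i))"
    by (intro sum.cong refl sum.swap)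
  also have "\<dots> = (\<Sum>i<l. \<Sum>u\<in>V. \<Sum>v\<in>V. (x u * p u $ i) * (x v * p v $ i))"
    by (rule sum.swap)
  also have "\<dots> = (\<Sum>i<l. (\<Sum>v\<in>V. x v * p v $ i)\<^sup>2)"
    by (simp add: power2_eq_square sum_product)
  also have "\<dots> \<ge> 0" by (intro sum_nonneg) simp
  finally show ?thesis .
qed

text \<open>
  By the symmetry of \<open>J\<close>, the left-hand side is half of the sum of
  \<open>\<beta> u * \<beta> v * (a u - a v)\<^sup>2\<close> over the pairs related by \<open>J\<close>. In this form all terms are
  nonnegative, so the indicator of \<open>J\<close> can be replaced by the larger \<open>\<Sum>\<sigma>\<in>S. M \<sigma> u v\<close>. Undoing the
  symmetrisation leaves row sums of \<open>M \<sigma>\<close>, which are bounded by \<open>s\<close>, minus a value of the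
  quadratic form of \<open>M \<sigma>\<close>, which is nonnegative.
\<close>

lemma laplacian_form_le:
  fixes M :: "'s \<Rightarrow> 'a \<Rightarrow> 'a \<Rightarrow> real"
  assumes fin: "finite V" "finite S"
    and \<beta>: "\<And>v. v \<in> V \<Longrightarrow> \<beta> v \<ge> 0"
    and J: "\<And>u v. J u v \<longleftrightarrow> J v u"
      "\<And>u v. u \<in> V \<Longrightarrow> v \<in> V \<Longrightarrow> J u v \<Longrightarrow> \<exists>\<sigma>\<in>S. M \<sigma> u v \<ge> 1"
    and M: "\<And>\<sigma> u v. \<sigma> \<in> S \<Longrightarrow> u \<in> V \<Longrightarrow> v \<in> V \<Longrightarrow> M \<sigma> u v \<ge> 0"
      "\<And>\<sigma> u v. \<sigma> \<in> S \<Longrightarrow> u \<in> V \<Longrightarrow> v \<in> V \<Longrightarrow> M \<sigma> u v = M \<sigma> v u"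
      "\<And>\<sigma> x. \<sigma> \<in> S \<Longrightarrow> (\<Sum>u\<in>V. \<Sum>v\<in>V. x u * x v * M \<sigma> u v) \<ge> 0"
      "\<And>\<sigma> u. \<sigma> \<in> S \<Longrightarrow> u \<in> V \<Longrightarrow> (\<Sum>v\<in>V. \<beta> v * M \<sigma> u v) \<le> s"
  shows "(\<Sum>u\<in>V. \<Sum>v\<in>V. \<beta> u * \<beta> v * (if J u v then (a u)\<^sup>2 - a u * a v else 0))
    \<le> real (card S) * s * (\<Sum>u\<in>V. \<beta> u * (a u)\<^sup>2)"
proof -
  have sym: "(\<Sum>u\<in>V. \<Sum>v\<in>V. c u v * (a u - a v)\<^sup>2) = 2 * (\<Sum>u\<in>V. \<Sum>v\<in>V. c u v * ((a u)\<^sup>2 - a u * a v))"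
    if c: "\<And>u v. u \<in> V \<Longrightarrow> v \<in> V \<Longrightarrow> c u v = c v u" for c :: "'a \<Rightarrow> 'a \<Rightarrow> real"
  proof -
    have "(\<Sum>u\<in>V. \<Sum>v\<in>V. c u v * (a u - a v)\<^sup>2) =
        (\<Sum>u\<in>V. \<Sum>v\<in>V. c u v * ((a u)\<^sup>2 - a u * a v)) + (\<Sum>u\<in>V. \<Sum>v\<in>V. c u v * ((a v)\<^sup>2 - a v * a u))"
      by (simp add: sum.distrib[symmetric] power2_eq_square algebra_simps)
    also have "(\<Sum>u\<in>V. \<Sum>v\<in>V. c u v * ((a v)\<^sup>2 - a v * a u)) =
        (\<Sum>v\<in>V. \<Sum>u\<in>V. c u v * ((a v)\<^sup>2 - a v * a u))"
      by (rule sum.swap)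
    also have "\<dots> = (\<Sum>u\<in>V. \<Sum>v\<in>V. c u v * ((a u)\<^sup>2 - a u * a v))"
      by (intro sum.cong refl) (simp add: c)
    finally show ?thesis by simp
  qed
  let ?j = "\<lambda>u v. \<beta> u * \<beta> v * (if J u v then 1 else 0)"
  have "2 * (\<Sum>u\<in>V. \<Sum>v\<in>V. \<beta> u * \<beta> v * (if J u v then (a u)\<^sup>2 - a u * a v else 0)) =
      2 * (\<Sum>u\<in>V. \<Sum>v\<in>V. ?j u v * ((a u)\<^sup>2 - a u * a v))"
    by (intro arg_cong[of _ _ "\<lambda>x. 2 * x"] sum.cong refl) simp
  also have "\<dots> = (\<Sum>u\<in>V. \<Sum>v\<in>V. ?j u v * (a u - a v)\<^sup>2)"
    by (rule sym[symmetric]) (simp add: J(1) mult.commute)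
  also have "\<dots> \<le> (\<Sum>u\<in>V. \<Sum>v\<in>V. (\<Sum>\<sigma>\<in>S. \<beta> u * \<beta> v * M \<sigma> u v) * (a u - a v)\<^sup>2)"
  proof (intro sum_mono mult_right_mono)
    fix u v assume uv: "u \<in> V" "v \<in> V"
    have "(if J u v then 1 else 0) \<le> (\<Sum>\<sigma>\<in>S. M \<sigma> u v)"
    proof (cases "J u v")
      case True
      then obtain \<sigma> where "\<sigma> \<in> S" "M \<sigma> u v \<ge> 1" using J(2) uv by blast
      moreover have "M \<sigma> u v \<le> (\<Sum>\<sigma>\<in>S. M \<sigma> u v)"
        using \<open>\<sigma> \<in> S\<close> fin uv M(1) by (intro member_le_sum) auto
      ultimately show ?thesis using True by simp
    qed (use uv M(1) in \<open>auto intro: sum_nonneg\<close>)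
    then have "\<beta> u * \<beta> v * (if J u v then 1 else 0) \<le> \<beta> u * \<beta> v * (\<Sum>\<sigma>\<in>S. M \<sigma> u v)"
      using \<beta> uv by (intro mult_left_mono) auto
    then show "?j u v \<le> (\<Sum>\<sigma>\<in>S. \<beta> u * \<beta> v * M \<sigma> u v)" by (simp add: sum_distrib_left)
  qed simp
  also have "\<dots> = 2 * (\<Sum>u\<in>V. \<Sum>v\<in>V. (\<Sum>\<sigma>\<in>S. \<beta> u * \<beta> v * M \<sigma> u v) * ((a u)\<^sup>2 - a u * a v))"
  proof (rule sym)
    show "(\<Sum>\<sigma>\<in>S. \<beta> u * \<beta> v * M \<sigma> u v) = (\<Sum>\<sigma>\<in>S. \<beta> v * \<beta> u * M \<sigma> v u)" if "u \<in> V" "v \<in> V" for u v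
      using that M(2) by (intro sum.cong refl) (simp add: mult.commute)
  qed
  also have "(\<Sum>u\<in>V. \<Sum>v\<in>V. (\<Sum>\<sigma>\<in>S. \<beta> u * \<beta> v * M \<sigma> u v) * ((a u)\<^sup>2 - a u * a v)) =
      (\<Sum>\<sigma>\<in>S. \<Sum>u\<in>V. \<Sum>v\<in>V. \<beta> u * \<beta> v * M \<sigma> u v * ((a u)\<^sup>2 - a u * a v))"
    by (simp add: sum_distrib_right sum.swap[of _ S V])
  also have "\<dots> \<le> (\<Sum>\<sigma>\<in>S. s * (\<Sum>u\<in>V. \<beta> u * (a u)\<^sup>2))"
  proof (rule sum_mono)
    fix \<sigma> assume \<sigma>: "\<sigma> \<in> S"
    have "(\<Sum>u\<in>V. \<Sum>v\<in>V. \<beta> u * \<beta> v * M \<sigma> u v * ((a u)\<^sup>2 - a u * a v)) =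
        (\<Sum>u\<in>V. \<beta> u * (a u)\<^sup>2 * (\<Sum>v\<in>V. \<beta> v * M \<sigma> u v))
        - (\<Sum>u\<in>V. \<Sum>v\<in>V. (\<beta> u * a u) * (\<beta> v * a v) * M \<sigma> u v)"
      by (simp add: sum_distrib_left sum_subtractf[symmetric] algebra_simps)
    also have "\<dots> \<le> (\<Sum>u\<in>V. \<beta> u * (a u)\<^sup>2 * (\<Sum>v\<in>V. \<beta> v * M \<sigma> u v))"
      using M(3)[OF \<sigma>, of "\<lambda>u. \<beta> u * a u"] by simp
    also have "\<dots> \<le> (\<Sum>u\<in>V. \<beta> u * (a u)\<^sup>2 * s)"
      using M(4)[OF \<sigma>] \<beta> by (intro sum_mono mult_left_mono) auto
    also have "\<dots> = s * (\<Sum>u\<in>V. \<beta> u * (a u)\<^sup>2)"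
      by (simp add: sum_distrib_left mult.commute)
    finally show "(\<Sum>u\<in>V. \<Sum>v\<in>V. \<beta> u * \<beta> v * M \<sigma> u v * ((a u)\<^sup>2 - a u * a v))
        \<le> s * (\<Sum>u\<in>V. \<beta> u * (a u)\<^sup>2)" .
  qed
  finally show ?thesis by (simp add: mult.assoc)
qed

section \<open>Missing faces and the coboundary of a cocycle\<close>

text \<open>
  The dimension \<open>card \<sigma> + 1\<close> forces \<open>u\<close> and \<open>v\<close> to be distinct and outside \<open>\<sigma>\<close>.
\<close>

definition share_missing_face :: "'a set \<Rightarrow> 'a set set \<Rightarrow> 'a \<Rightarrow> 'a \<Rightarrow> 'a list \<Rightarrow> bool" where
  "share_missing_face V X u v ys \<longleftrightarrow>
    (\<exists>\<sigma>\<subseteq>set ys. {u, v} \<union> \<sigma> \<in> missing_faces V X (card \<sigma> + 1))"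

lemma share_missing_face_commute: "share_missing_face V X u v ys \<longleftrightarrow> share_missing_face V X v u ys"
  by (simp add: share_missing_face_def insert_commute)

lemma share_missing_faceI:
  assumes "missing_face V X \<mu>" "finite \<mu>" "u \<in> \<mu>" "v \<in> \<mu>" "u \<noteq> v" "\<mu> - {u, v} \<subseteq> set ys"
  shows "share_missing_face V X u v ys"
proof -
  have "card \<mu> = card (\<mu> - {u, v}) + 2"
    using assms card_Diff_subset[of "{u, v}" \<mu>] card_mono[of \<mu> "{u, v}"] by simp
  moreover have "{u, v} \<union> (\<mu> - {u, v}) = \<mu>" using assms by auto
  ultimately have "{u, v} \<union> (\<mu> - {u, v}) \<in> missing_faces V X (card (\<mu> - {u, v}) + 1)"
    using assms(1) by (simp add: missing_faces_def sdim_def)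
  then show ?thesis using assms(6) unfolding share_missing_face_def by blast
qed

lemma nonface_contains_missing_face:
  assumes "finite \<tau>" "\<tau> \<subseteq> V" "\<tau> \<notin> X"
  obtains \<mu> where "missing_face V X \<mu>" "\<mu> \<subseteq> \<tau>"
proof -
  have "finite {\<rho>. \<rho> \<subseteq> \<tau> \<and> \<rho> \<notin> X}" "{\<rho>. \<rho> \<subseteq> \<tau> \<and> \<rho> \<notin> X} \<noteq> {}"
    using assms by auto
  from finite_has_minimal[OF this] obtain \<mu> where
    \<mu>: "\<mu> \<in> {\<rho>. \<rho> \<subseteq> \<tau> \<and> \<rho> \<notin> X}" "\<forall>\<rho>\<in>{\<rho>. \<rho> \<subseteq> \<tau> \<and> \<rho> \<notin> X}. \<rho> \<subseteq> \<mu> \<longrightarrow> \<mu> = \<rho>"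
    by (rule bexE)
  have "\<rho> \<in> X" if "\<rho> \<subset> \<mu>" for \<rho>
  proof (rule ccontr)
    assume "\<rho> \<notin> X"
    then have "\<rho> \<in> {\<rho>. \<rho> \<subseteq> \<tau> \<and> \<rho> \<notin> X}" using \<mu>(1) that by auto
    then show False using \<mu>(2) that by blast
  qed
  then show thesis
    using \<mu>(1) assms(2) by (intro that[of \<mu>]) (auto simp: missing_face_def)
qed

text \<open>
  If \<open>f xs = 0\<close> or if \<open>v # xs\<close>, possibly with a repeated entry, spans a face, then both sides
  are zero. Otherwise \<open>xs\<close> spans a face, but \<open>v # xs\<close> does not, so some missing face
  \<open>\<mu>\<close> lies inside \<open>v # xs\<close>, and it contains \<open>v\<close>. If \<open>f\<close> is nonzero on
  \<open>v # remove_nth i xs\<close>, this list spans a face, so \<open>\<mu>\<close> must contain the removed vertex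
  \<open>xs ! i\<close>. Hence the coboundary has, apart from \<open>f xs\<close>, nonzero terms only at the indices \<open>i\<close> such
  that \<open>xs ! i\<close> and \<open>v\<close> share a missing face. As the set \<open>T\<close> of these indices is nonempty, the single square \<open>(f xs)\<^sup>2\<close> on the left is at most one square for each index in \<open>T\<close>.
\<close>

lemma cocycle_coboundary_bound:
  assumes fsc: "finite_simplicial_complex V X"
    and f: "f \<in> cocycles X (int m - 1)"
    and xs: "xs \<in> tuples V m" and v: "v \<in> V"
  shows "f xs * full_coboundary f (v # xs) \<le>
    (\<Sum>i<m. if share_missing_face V X (xs ! i) v (remove_nth i xs)
      then (f xs)\<^sup>2 - f xs * ((-1) ^ i * f (v # remove_nth i xs)) else 0)"
proof -
  have X: "X \<subseteq> Pow V" "\<And>\<sigma> \<tau>. \<sigma> \<in> X \<Longrightarrow> \<tau> \<subseteq> \<sigma> \<Longrightarrow> \<tau> \<in> X" "{v} \<in> X" "finite V"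
    using fsc v by (auto simp: finite_simplicial_complex_def)
  have alt: "alternating f" and supp: "\<And>xs. \<not> (distinct xs \<and> set xs \<in> X \<and> length xs = m) \<Longrightarrow> f xs = 0"
    using f by (auto simp: cocycles_def cochains_iff ordered_simplices_iff)
  have len: "length xs = m" "set xs \<subseteq> V" using xs by (auto simp: tuples_def)
  have rem: "set (remove_nth i xs) \<subseteq> set xs" for i by (rule set_remove_nth_subset)
  show ?thesis
  proof (cases "distinct xs \<and> set xs \<in> X")
    case False
    then have "f xs = 0" using supp by blast
    then show ?thesis by (auto intro!: sum_nonneg)
  next
    case True
    show ?thesis
    proof (cases "set (v # xs) \<in> X")
      case face: True
      have "full_coboundary f (v # xs) = 0"
      proof (cases "v \<in> set xs")
        case True
        then show ?thesis
          by (intro alternating_not_distinct alternating_full_coboundary alt) simp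
      next
        case False
        then have "v # xs \<in> ordered_simplices X (int (Suc m) - 1)"
          using True face len by (simp add: ordered_simplices_iff del: of_nat_Suc)
        then have "full_coboundary f (v # xs) = coboundary X (int m - 1) f (v # xs)"
          by (simp add: coboundary_eq)
        then show ?thesis using f by (simp add: cocycles_def)
      qed
      moreover have "\<not> share_missing_face V X (xs ! i) v (remove_nth i xs)" if "i < m" for i
      proof
        assume "share_missing_face V X (xs ! i) v (remove_nth i xs)"
        then obtain \<sigma> where "\<sigma> \<subseteq> set (remove_nth i xs)"
            "{xs ! i, v} \<union> \<sigma> \<in> missing_faces V X (card \<sigma> + 1)"
          unfolding share_missing_face_def by blast
        then have "\<sigma> \<subseteq> set xs" "{xs ! i, v} \<union> \<sigma> \<notin> X"
          using rem[of i] by (simp_all add: missing_faces_def missing_face_def)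
        moreover have "xs ! i \<in> set xs" using that len by simp
        ultimately show False using X(2)[OF face, of "{xs ! i, v} \<union> \<sigma>"] by auto
      qed
      ultimately show ?thesis by simp
    next
      case nonface: False
      then have v_notin: "v \<notin> set xs" using True by (auto simp: insert_absorb)
      obtain \<mu> where \<mu>: "missing_face V X \<mu>" "\<mu> \<subseteq> insert v (set xs)"
        using nonface_contains_missing_face[of "set (v # xs)" V X] nonface v len by auto
      have \<mu>X: "\<mu> \<notin> X" using \<mu>(1) by (simp add: missing_face_def)
      have v\<mu>: "v \<in> \<mu>" using \<mu>(2) \<mu>X True X(2) by (metis subset_insert)
      define T where "T = {i. i < m \<and> share_missing_face V X (xs ! i) v (remove_nth i xs)}"
      have set_rem: "set (remove_nth i xs) = set xs - {xs ! i}" if "i < m" for i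
        using True that len by (intro set_remove_nth) auto
      have in_T: "i \<in> T" if "i < m" "xs ! i \<in> \<mu>" for i
      proof -
        have "xs ! i \<noteq> v" using that v_notin len by (metis nth_mem)
        moreover have "finite \<mu>" using \<mu>(2) finite_subset by blast
        moreover have "\<mu> - {xs ! i, v} \<subseteq> set (remove_nth i xs)" using \<mu>(2) set_rem that by auto
        ultimately show ?thesis
          using \<mu>(1) v\<mu> that by (auto simp: T_def intro: share_missing_faceI)
      qed
      have "T \<noteq> {}"
      proof
        assume "T = {}"
        then have "\<mu> \<inter> set xs = {}" using in_T len by (auto simp: in_set_conv_nth)
        then have "\<mu> \<subseteq> {v}" using \<mu>(2) by auto
        then show False using X(2,3) \<mu>X by blast
      qed
      define c where "c i = (-1) ^ i * f (v # remove_nth i xs)" for i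
      have c0: "c i = 0" if "i < m" "i \<notin> T" for i
      proof -
        have "\<mu> \<subseteq> set (v # remove_nth i xs)" using in_T[OF that(1)] that \<mu>(2) set_rem by auto
        then have "set (v # remove_nth i xs) \<notin> X" using \<mu>X X(2) by blast
        then show ?thesis using supp[of "v # remove_nth i xs"] by (simp add: c_def)
      qed
      have "full_coboundary f (v # xs) = f xs - (\<Sum>i<m. c i)"
        by (simp add: full_coboundary_Cons full_coboundary_def[of _ xs] len c_def)
      also have "(\<Sum>i<m. c i) = (\<Sum>i\<in>T. c i)"
        using c0 by (intro sum.mono_neutral_right) (auto simp: T_def)
      finally have "f xs * full_coboundary f (v # xs) = (f xs)\<^sup>2 - (\<Sum>i\<in>T. f xs * c i)"
        by (simp add: right_diff_distrib power2_eq_square sum_distrib_left)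
      also have "\<dots> \<le> real (card T) * (f xs)\<^sup>2 - (\<Sum>i\<in>T. f xs * c i)"
      proof -
        have "finite T" by (simp add: T_def)
        then have "real (card T) \<ge> 1" using \<open>T \<noteq> {}\<close> by (simp add: Suc_le_eq card_gt_0_iff)
        then show ?thesis by (simp add: mult_le_cancel_right1)
      qed
      also have "\<dots> = (\<Sum>i\<in>T. (f xs)\<^sup>2 - f xs * c i)" by (simp add: sum_subtractf)
      also have "\<dots> = (\<Sum>i<m. if share_missing_face V X (xs ! i) v (remove_nth i xs)
          then (f xs)\<^sup>2 - f xs * c i else 0)"
        by (simp add: T_def sum.If_cases Int_def lessThan_def)
      finally show ?thesis unfolding c_def .
    qed
  qed
qed

lemma missing_dims_bounds:
  assumes "finite_simplicial_complex V X" "r \<in> missing_dims V X"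
  shows "1 \<le> r" "r \<le> card V"
proof -
  obtain \<mu> where \<mu>: "\<mu> \<subseteq> V" "\<mu> \<notin> X" "int (card \<mu>) - 1 = int r"
    using assms(2) by (auto simp: missing_dims_def missing_faces_def missing_face_def sdim_def)
  have fin: "finite V" "finite \<mu>" using assms(1) \<mu>(1) finite_subset
    by (auto simp: finite_simplicial_complex_def)
  have "card \<mu> \<noteq> 1" using \<mu>(1,2) assms(1) by (auto simp: card_1_singleton_iff finite_simplicial_complex_def)
  then show "1 \<le> r" using \<mu>(3) by linarith
  show "r \<le> card V" using card_mono[OF fin(1) \<mu>(1)] \<mu>(3) by linarith
qed

lemma finite_missing_dims:
  assumes "finite_simplicial_complex V X"
  shows "finite (missing_dims V X)"
proof (rule finite_subset)
  show "missing_dims V X \<subseteq> {..card V}" using missing_dims_bounds(2)[OF assms] by auto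
qed simp

lemma card_index_simplices_within_le:
  assumes fsc: "finite_simplicial_complex V X"
  shows "card {\<sigma>. \<sigma> \<subseteq> set ys \<and> card \<sigma> + 1 \<in> missing_dims V X}
    \<le> (\<Sum>r\<in>missing_dims V X. length ys choose (r - 1))"
proof -
  have "{\<sigma>. \<sigma> \<subseteq> set ys \<and> card \<sigma> + 1 \<in> missing_dims V X} \<subseteq>
      (\<Union>r\<in>missing_dims V X. {\<sigma>. \<sigma> \<subseteq> set ys \<and> card \<sigma> = r - 1})"
    by force
  then have "card {\<sigma>. \<sigma> \<subseteq> set ys \<and> card \<sigma> + 1 \<in> missing_dims V X} \<le>
      card (\<Union>r\<in>missing_dims V X. {\<sigma>. \<sigma> \<subseteq> set ys \<and> card \<sigma> = r - 1})"
    using finite_missing_dims[OF fsc] by (intro card_mono) auto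
  also have "\<dots> \<le> (\<Sum>r\<in>missing_dims V X. card {\<sigma>. \<sigma> \<subseteq> set ys \<and> card \<sigma> = r - 1})"
    by (rule card_UN_le[OF finite_missing_dims[OF fsc]])
  also have "\<dots> \<le> (\<Sum>r\<in>missing_dims V X. length ys choose (r - 1))"
    by (intro sum_mono) (simp add: n_subsets binomial_right_mono card_length)
  finally show ?thesis .
qed

section \<open>The weighted number of vertices\<close>

text \<open>
  The spectral estimate for positive weights. The two sides, multiplied by the squared norm \<open>N\<close> of a
  harmonic cochain \<open>f\<close>, are compared through \<open>\<langle>f, d\<^sup>* d f\<rangle>\<close>.
\<close>

lemma total_weight_le:
  assumes fsc: "finite_simplicial_complex V X" and P: "vector_representation V X P"
    and \<beta>: "\<And>v. v \<in> V \<Longrightarrow> \<beta> v > 0" and s: "s \<ge> 0"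
    and row: "\<And>\<sigma> u. \<sigma> \<in> index_simplices V X \<Longrightarrow> u \<in> V \<Longrightarrow> (\<Sum>v\<in>V. \<beta> v * (P \<sigma> u \<bullet> P \<sigma> v)) \<le> s"
    and nontrivial: "reduced_cohomology X (int m - 1) \<noteq> {coboundaries X (int m - 1)}"
  shows "sum \<beta> V \<le> s * (\<Sum>r\<in>missing_dims V X. real r * real (m choose r))"
proof -
  have V: "finite V" "X \<subseteq> Pow V" and X: "\<forall>\<sigma>\<in>X. \<forall>\<tau>. \<tau> \<subseteq> \<sigma> \<longrightarrow> \<tau> \<in> X"
    using fsc by (auto simp: finite_simplicial_complex_def)
  obtain f where f: "f \<in> cocycles X (int m - 1)" "f \<noteq> (\<lambda>_. 0)"
    and orth: "\<forall>g\<in>coboundaries X (int m - 1). (\<Sum>xs\<in>tuples V m. weight \<beta> xs * f xs * g xs) = 0"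
    by (rule harmonic_representative[where m = m and \<beta> = \<beta>, OF V X \<beta> nontrivial]) blast
  have alt: "alternating f" and supp: "\<And>xs. xs \<notin> ordered_simplices X (int m - 1) \<Longrightarrow> f xs = 0"
    using f(1) by (auto simp: cocycles_def cochains_iff)
  have w: "weight \<beta> xs > 0" if "xs \<in> tuples V k" for xs k
    using that \<beta> by (intro weight_pos) (auto simp: tuples_def)
  define N where "N = (\<Sum>xs\<in>tuples V m. weight \<beta> xs * (f xs)\<^sup>2)"
  have "N > 0"
  proof -
    obtain xs where xs: "f xs \<noteq> 0" using f(2) by blast
    then have mem: "xs \<in> tuples V m"
      using supp ordered_simplices_subset_tuples[OF V(2), of m] by blast
    show ?thesis unfolding N_def
      by (rule sum_pos2[OF finite_tuples[OF V(1)] mem]) (use xs w[OF mem] w in \<open>auto simp: less_imp_le\<close>)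
  qed
  define h where "h = contraction V \<beta> f"
  have h: "h \<in> cochains X (int m - 1 - 1)"
  proof -
    have "f (v # xs) = 0" if "xs \<notin> ordered_simplices X (int m - 1 - 1)" for v xs
    proof (rule supp)
      show "v # xs \<notin> ordered_simplices X (int m - 1)"
        using remove_nth_ordered_simplex[OF X, of "v # xs" "int m - 1 - 1" 0] that by auto
    qed
    then show ?thesis
      using alternating_contraction[OF alt] by (auto simp: cochains_iff h_def contraction_def)
  qed
  \<comment> \<open>\<open>h\<close> is itself a cochain of \<open>X\<close>, so \<open>f\<close> is orthogonal to its coboundary.\<close>
  have h_orth: "(\<Sum>xs\<in>tuples V m. weight \<beta> xs * f xs * full_coboundary h xs) = 0"
  proof -
    have "(\<Sum>xs\<in>tuples V m. weight \<beta> xs * f xs * full_coboundary h xs) =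
        (\<Sum>xs\<in>tuples V m. weight \<beta> xs * f xs * coboundary X (int m - 1 - 1) h xs)"
      by (intro sum.cong refl) (auto simp: coboundary_eq supp)
    also have "\<dots> = 0" using h by (intro orth[rule_format]) (auto simp: coboundaries_def)
    finally show ?thesis .
  qed
  define G where "G v u ys = weight \<beta> ys * (\<beta> u * \<beta> v *
      (if share_missing_face V X u v ys then (f (u # ys))\<^sup>2 - f (u # ys) * f (v # ys) else 0))" for v u ys
  have "sum \<beta> V * N = (\<Sum>xs\<in>tuples V m. weight \<beta> xs * f xs * (sum \<beta> V * f xs))"
    unfolding N_def sum_distrib_left[of "sum \<beta> V"] power2_eq_square
    by (intro sum.cong refl) (simp only: mult_ac)
  also have "\<dots> = (\<Sum>xs\<in>tuples V m. weight \<beta> xs * f xs * (sum \<beta> V * f xs))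
      - (\<Sum>xs\<in>tuples V m. weight \<beta> xs * f xs * full_coboundary h xs)"
    by (simp add: h_orth)
  also have "\<dots> = (\<Sum>xs\<in>tuples V m. weight \<beta> xs * f xs * contraction V \<beta> (full_coboundary f) xs)"
    by (simp add: contraction_full_coboundary h_def right_diff_distrib sum_subtractf)
  also have "\<dots> = (\<Sum>xs\<in>tuples V m. \<Sum>v\<in>V. weight \<beta> xs * \<beta> v * (f xs * full_coboundary f (v # xs)))"
    by (simp add: contraction_def sum_distrib_left mult_ac)
  also have "\<dots> \<le> (\<Sum>xs\<in>tuples V m. \<Sum>v\<in>V. weight \<beta> xs * \<beta> v *
      (\<Sum>i<m. if share_missing_face V X (xs ! i) v (remove_nth i xs)
        then (f xs)\<^sup>2 - f xs * ((-1) ^ i * f (v # remove_nth i xs)) else 0))"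
    using w \<beta> by (intro sum_mono mult_left_mono cocycle_coboundary_bound[OF fsc f(1)])
      (auto simp: less_imp_le)
  also have "\<dots> = (\<Sum>xs\<in>tuples V m. \<Sum>v\<in>V. \<Sum>i<m. G v (xs ! i) (remove_nth i xs))"
  proof (intro sum.cong refl)
    fix xs v assume xs: "xs \<in> tuples V m"
    have "weight \<beta> xs * \<beta> v * (if share_missing_face V X (xs ! i) v (remove_nth i xs)
        then (f xs)\<^sup>2 - f xs * ((-1) ^ i * f (v # remove_nth i xs)) else 0) =
        G v (xs ! i) (remove_nth i xs)" if "i < m" for i
    proof -
      have i: "i < length xs" using that xs by (simp add: tuples_def)
      \<comment> \<open>Moving \<open>xs ! i\<close> to the front makes the summand a function of \<open>xs ! i\<close> and the remaining tuple.\<close>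
      have "f xs = (-1) ^ i * f (xs ! i # remove_nth i xs)"
        using alternating_move_to_front[OF alt, of "take i xs" "xs ! i" "drop (Suc i) xs"] i
        by (simp add: remove_nth_def id_take_nth_drop[symmetric])
      then have "(f xs)\<^sup>2 - f xs * ((-1) ^ i * f (v # remove_nth i xs)) =
          ((-1) ^ i * (-1) ^ i) * ((f (xs ! i # remove_nth i xs))\<^sup>2
            - f (xs ! i # remove_nth i xs) * f (v # remove_nth i xs))"
        by (simp only: power2_eq_square) (simp add: algebra_simps)
      also have "(-1) ^ i * (-1) ^ i = (1::real)" by (simp add: power_mult_distrib[symmetric])
      finally show ?thesis
        by (simp add: G_def weight_remove_nth[OF i, of \<beta>])
    qed
    then show "weight \<beta> xs * \<beta> v * (\<Sum>i<m. if share_missing_face V X (xs ! i) v (remove_nth i xs)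
        then (f xs)\<^sup>2 - f xs * ((-1) ^ i * f (v # remove_nth i xs)) else 0) =
        (\<Sum>i<m. G v (xs ! i) (remove_nth i xs))"
      by (simp add: sum_distrib_left)
  qed
  also have "\<dots> \<le> s * (\<Sum>r\<in>missing_dims V X. real r * real (m choose r)) * N"
  proof (cases m)
    case 0
    then show ?thesis
      using s \<open>N > 0\<close> by (auto intro!: mult_nonneg_nonneg sum_nonneg)
  next
    case (Suc n)
    define c where "c = (\<Sum>r\<in>missing_dims V X. n choose (r - 1))"
    \<comment> \<open>For a fixed \<open>ys\<close>, the estimate is one for quadratic forms in the values \<open>f (u # ys)\<close>.\<close>
    have fibre: "(\<Sum>u\<in>V. \<Sum>v\<in>V. G v u ys) \<le>
        real c * s * (\<Sum>u\<in>V. \<beta> u * weight \<beta> ys * (f (u # ys))\<^sup>2)" if ys: "ys \<in> tuples V n" for ys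
    proof -
      define S where "S = {\<sigma>. \<sigma> \<subseteq> set ys \<and> card \<sigma> + 1 \<in> missing_dims V X}"
      have sub: "S \<subseteq> index_simplices V X"
      proof
        fix \<sigma> assume "\<sigma> \<in> S"
        then show "\<sigma> \<in> index_simplices V X"
          using ys unfolding index_simplices_def
          by (intro UN_I[of "card \<sigma> + 1"]) (auto simp: S_def tuples_def)
      qed
      have rep: "vector_representation_at V X \<sigma> (P \<sigma>)" if "\<sigma> \<in> S" for \<sigma>
        using P sub that by (auto simp: vector_representation_def)
      have "(\<Sum>u\<in>V. \<Sum>v\<in>V. \<beta> u * \<beta> v *
            (if share_missing_face V X u v ys then (f (u # ys))\<^sup>2 - f (u # ys) * f (v # ys) else 0))
          \<le> real (card S) * s * (\<Sum>u\<in>V. \<beta> u * (f (u # ys))\<^sup>2)"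
      proof (rule laplacian_form_le[where M = "\<lambda>\<sigma> u v. P \<sigma> u \<bullet> P \<sigma> v"])
        show "finite V" "finite S" using V(1) by (auto simp: S_def)
        show "\<beta> v \<ge> 0" if "v \<in> V" for v using \<beta>[OF that] by simp
        show "share_missing_face V X u v ys \<longleftrightarrow> share_missing_face V X v u ys" for u v
          by (rule share_missing_face_commute)
        show "\<exists>\<sigma>\<in>S. P \<sigma> u \<bullet> P \<sigma> v \<ge> 1" if uv: "u \<in> V" "v \<in> V" and share: "share_missing_face V X u v ys" for u v
        proof -
          obtain \<sigma> where \<sigma>: "\<sigma> \<subseteq> set ys" "{u, v} \<union> \<sigma> \<in> missing_faces V X (card \<sigma> + 1)"
            using share unfolding share_missing_face_def by blast
          then have "\<sigma> \<in> S" by (auto simp: S_def missing_dims_def)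
          then show ?thesis using rep \<sigma>(2) uv by (force simp: vector_representation_at_def)
        qed
        show "P \<sigma> u \<bullet> P \<sigma> v \<ge> 0" if "\<sigma> \<in> S" "u \<in> V" "v \<in> V" for \<sigma> u v
          using rep[OF that(1)] that(2,3) unfolding vector_representation_at_def
          by (metis order_trans zero_le_one)
        show "P \<sigma> u \<bullet> P \<sigma> v = P \<sigma> v \<bullet> P \<sigma> u" if "\<sigma> \<in> S" "u \<in> V" "v \<in> V" for \<sigma> u v
          using rep[OF that(1)] that(2,3) unfolding vector_representation_at_def
          by (metis comm_scalar_prod)
        show "(\<Sum>u\<in>V. \<Sum>v\<in>V. x u * x v * (P \<sigma> u \<bullet> P \<sigma> v)) \<ge> 0" if "\<sigma> \<in> S" for \<sigma> x
          using rep[OF that] gram_matrix_nonneg[of V "P \<sigma>"] unfolding vector_representation_at_def by blast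
        show "(\<Sum>v\<in>V. \<beta> v * (P \<sigma> u \<bullet> P \<sigma> v)) \<le> s" if "\<sigma> \<in> S" "u \<in> V" for \<sigma> u
          using row sub that by blast
      qed
      also have "\<dots> \<le> real c * s * (\<Sum>u\<in>V. \<beta> u * (f (u # ys))\<^sup>2)"
      proof -
        have "card S \<le> c"
          using card_index_simplices_within_le[OF fsc, of ys] ys by (simp add: S_def c_def tuples_def)
        moreover have "(\<Sum>u\<in>V. \<beta> u * (f (u # ys))\<^sup>2) \<ge> 0"
          using \<beta> by (intro sum_nonneg) (simp add: less_imp_le)
        ultimately show ?thesis using s by (intro mult_right_mono) auto
      qed
      finally have "weight \<beta> ys * (\<Sum>u\<in>V. \<Sum>v\<in>V. \<beta> u * \<beta> v *
            (if share_missing_face V X u v ys then (f (u # ys))\<^sup>2 - f (u # ys) * f (v # ys) else 0))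
          \<le> weight \<beta> ys * (real c * s * (\<Sum>u\<in>V. \<beta> u * (f (u # ys))\<^sup>2))"
        using w[OF ys] by (intro mult_left_mono) auto
      then show ?thesis by (simp add: G_def sum_distrib_left mult_ac)
    qed
    have "(\<Sum>xs\<in>tuples V m. \<Sum>v\<in>V. \<Sum>i<m. G v (xs ! i) (remove_nth i xs)) =
        (\<Sum>i<m. \<Sum>v\<in>V. \<Sum>xs\<in>tuples V m. G v (xs ! i) (remove_nth i xs))"
      by (simp only: sum.swap[of _ "{..<m}"] sum.swap[of _ V "tuples V m"])
    also have "\<dots> = (\<Sum>i<m. \<Sum>v\<in>V. \<Sum>u\<in>V. \<Sum>ys\<in>tuples V n. G v u ys)"
      unfolding Suc by (intro sum.cong refl sum_tuples_remove_nth) simp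
    also have "\<dots> = real m * (\<Sum>v\<in>V. \<Sum>u\<in>V. \<Sum>ys\<in>tuples V n. G v u ys)" by simp
    also have "(\<Sum>v\<in>V. \<Sum>u\<in>V. \<Sum>ys\<in>tuples V n. G v u ys) = (\<Sum>ys\<in>tuples V n. \<Sum>u\<in>V. \<Sum>v\<in>V. G v u ys)"
    proof -
      have "(\<Sum>v\<in>V. \<Sum>u\<in>V. \<Sum>ys\<in>tuples V n. G v u ys) = (\<Sum>u\<in>V. \<Sum>v\<in>V. \<Sum>ys\<in>tuples V n. G v u ys)"
        by (rule sum.swap)
      also have "\<dots> = (\<Sum>u\<in>V. \<Sum>ys\<in>tuples V n. \<Sum>v\<in>V. G v u ys)"
        by (intro sum.cong refl sum.swap)
      also have "\<dots> = (\<Sum>ys\<in>tuples V n. \<Sum>u\<in>V. \<Sum>v\<in>V. G v u ys)"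
        by (rule sum.swap)
      finally show ?thesis .
    qed
    also have "real m * \<dots> \<le> real m * (\<Sum>ys\<in>tuples V n. real c * s * (\<Sum>u\<in>V. \<beta> u * weight \<beta> ys * (f (u # ys))\<^sup>2))"
      by (intro mult_left_mono sum_mono fibre) auto
    also have "\<dots> = real (m * c) * s * (\<Sum>ys\<in>tuples V n. \<Sum>u\<in>V. \<beta> u * weight \<beta> ys * (f (u # ys))\<^sup>2)"
      by (simp add: sum_distrib_left mult.assoc)
    also have "(\<Sum>ys\<in>tuples V n. \<Sum>u\<in>V. \<beta> u * weight \<beta> ys * (f (u # ys))\<^sup>2) = N"
      unfolding N_def Suc sum_tuples_Suc by (subst sum.swap) simp
    also have "m * c = (\<Sum>r\<in>missing_dims V X. r * (m choose r))"
      unfolding c_def sum_distrib_left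
    proof (intro sum.cong refl)
      fix r assume "r \<in> missing_dims V X"
      then have "0 < r" using missing_dims_bounds(1)[OF fsc, of r] by simp
      from times_binomial_minus1_eq[OF this, of m] show "m * (n choose (r - 1)) = r * (m choose r)"
        by (simp add: Suc)
    qed
    finally show ?thesis by (simp add: mult_ac)
  qed
  finally show ?thesis using \<open>N > 0\<close> by simp
qed

text \<open>
  Weights that vanish somewhere do not define an inner product. Adding a small constant \<open>d\<close> to the
  weight raises the row sums by at most \<open>d * C\<close>, and \<open>d\<close> tends to zero.
\<close>

lemma total_weight_le_nonneg:
  assumes fsc: "finite_simplicial_complex V X" and P: "vector_representation V X P"
    and y: "\<And>v. v \<in> V \<Longrightarrow> y v \<ge> 0" and s: "s \<ge> 0"
    and row: "\<And>\<sigma> u. \<sigma> \<in> index_simplices V X \<Longrightarrow> u \<in> V \<Longrightarrow> (\<Sum>v\<in>V. y v * (P \<sigma> u \<bullet> P \<sigma> v)) \<le> s"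
    and nontrivial: "reduced_cohomology X (int m - 1) \<noteq> {coboundaries X (int m - 1)}"
  shows "sum y V \<le> s * (\<Sum>r\<in>missing_dims V X. real r * real (m choose r))"
proof (rule field_le_epsilon)
  fix e :: real assume "e > 0"
  define c where "c = (\<Sum>r\<in>missing_dims V X. real r * real (m choose r))"
  have V: "finite V" using fsc by (simp add: finite_simplicial_complex_def)
  have I: "finite (index_simplices V X)"
    using V by (intro finite_subset[of "index_simplices V X" "Pow V"]) (auto simp: index_simplices_def)
  define C where "C = (\<Sum>\<sigma>\<in>index_simplices V X. \<Sum>u\<in>V. \<bar>\<Sum>v\<in>V. P \<sigma> u \<bullet> P \<sigma> v\<bar>)"
  have C: "(\<Sum>v\<in>V. P \<sigma> u \<bullet> P \<sigma> v) \<le> C" if "\<sigma> \<in> index_simplices V X" "u \<in> V" for \<sigma> u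
  proof -
    have "(\<Sum>v\<in>V. P \<sigma> u \<bullet> P \<sigma> v) \<le> \<bar>\<Sum>v\<in>V. P \<sigma> u \<bullet> P \<sigma> v\<bar>" by simp
    also have "\<dots> \<le> (\<Sum>u\<in>V. \<bar>\<Sum>v\<in>V. P \<sigma> u \<bullet> P \<sigma> v\<bar>)"
      using that V by (intro member_le_sum) auto
    also have "\<dots> \<le> C"
      unfolding C_def using that I by (intro member_le_sum) (auto intro: sum_nonneg)
    finally show ?thesis .
  qed
  have "C \<ge> 0" "c \<ge> 0" by (auto simp: C_def c_def intro!: sum_nonneg)
  \<comment> \<open>The summand 1 keeps the denominator positive; the choice makes \<open>d * C * c\<close> at most \<open>e\<close>.\<close>
  define d where "d = e / (C * c + 1)"
  have d: "d > 0" "d * (C * c) \<le> e"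
    using \<open>e > 0\<close> \<open>C \<ge> 0\<close> \<open>c \<ge> 0\<close> by (auto simp: d_def field_simps add_pos_nonneg add_nonneg_pos)
  have "sum y V \<le> (\<Sum>v\<in>V. y v + d)"
    using d by (intro sum_mono) simp
  also have "\<dots> \<le> (s + d * C) * c"
    unfolding c_def
  proof (rule total_weight_le[OF fsc P _ _ _ nontrivial])
    show "y v + d > 0" if "v \<in> V" for v using y[OF that] d by simp
    show "s + d * C \<ge> 0" using s d \<open>C \<ge> 0\<close> by simp
    fix \<sigma> u assume *: "\<sigma> \<in> index_simplices V X" "u \<in> V"
    have "(\<Sum>v\<in>V. (y v + d) * (P \<sigma> u \<bullet> P \<sigma> v)) =
        (\<Sum>v\<in>V. y v * (P \<sigma> u \<bullet> P \<sigma> v)) + d * (\<Sum>v\<in>V. P \<sigma> u \<bullet> P \<sigma> v)"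
      by (simp add: distrib_right sum.distrib sum_distrib_left)
    also have "\<dots> \<le> s + d * C" using row[OF *] C[OF *] d by (intro add_mono mult_left_mono) auto
    finally show "(\<Sum>v\<in>V. (y v + d) * (P \<sigma> u \<bullet> P \<sigma> v)) \<le> s + d * C" .
  qed
  also have "\<dots> \<le> s * c + e" using d by (simp add: algebra_simps)
  finally show "sum y V \<le> s * (\<Sum>r\<in>missing_dims V X. real r * real (m choose r)) + e"
    by (simp add: c_def)
qed

lemma domination_Gamma_le:
  assumes fsc: "finite_simplicial_complex V X"
    and nontrivial: "reduced_cohomology X (int m - 1) \<noteq> {coboundaries X (int m - 1)}"
  shows "domination_Gamma V X \<le> ereal (\<Sum>r\<in>missing_dims V X. real r * real (m choose r))"
  unfolding domination_Gamma_def
proof (rule SUP_least)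
  fix P assume "P \<in> {P. vector_representation V X P}"
  then have P: "vector_representation V X P" by simp
  let ?I = "index_simplices V X" and ?c = "\<Sum>r\<in>missing_dims V X. real r * real (m choose r)"
  have V: "finite V" using fsc by (simp add: finite_simplicial_complex_def)
  have I: "finite ?I"
    using V by (intro finite_subset[of ?I "Pow V"]) (auto simp: index_simplices_def)
  have "\<exists>x. (\<forall>i\<in>?I \<times> V. x i \<ge> 0) \<and>
      (\<forall>w\<in>V. (\<Sum>i\<in>?I \<times> V. x i * (P (fst i) (snd i) \<bullet> P (fst i) w)) \<ge> 1) \<and> sum x (?I \<times> V) \<le> ?c"
  proof (rule linear_program_duality)
    fix y s assume y: "\<And>w. w \<in> V \<Longrightarrow> y w \<ge> 0" and s: "s \<ge> (0::real)"
      and row: "\<And>i. i \<in> ?I \<times> V \<Longrightarrow> (\<Sum>w\<in>V. y w * (P (fst i) (snd i) \<bullet> P (fst i) w)) \<le> s"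
    show "sum y V \<le> s * ?c"
      by (rule total_weight_le_nonneg[OF fsc P y s _ nontrivial]) (use row[of "(_, _)"] in auto)
  qed (use V I in auto)
  then obtain x where x: "\<forall>i\<in>?I \<times> V. x i \<ge> 0"
      "\<forall>w\<in>V. (\<Sum>i\<in>?I \<times> V. x i * (P (fst i) (snd i) \<bullet> P (fst i) w)) \<ge> 1" "sum x (?I \<times> V) \<le> ?c"
    by blast
  have "dominating V X P (\<lambda>\<sigma> v. x (\<sigma>, v))"
    using x(1,2) by (auto simp: dominating_def sum.cartesian_product case_prod_unfold)
  moreover have "(\<Sum>\<sigma>\<in>?I. \<Sum>v\<in>V. x (\<sigma>, v)) \<le> ?c"
    using x(3) by (simp add: sum.cartesian_product case_prod_unfold)
  ultimately show "rep_value V X P \<le> ereal ?c"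
    unfolding rep_value_def by (intro INF_lower2[of "\<lambda>\<sigma> v. x (\<sigma>, v)"]) auto
qed

text \<open>
  Degrees below \<open>-1\<close> have trivial cohomology, so the infimum over the degrees with nontrivial
  cohomology is attained, by \<open>m - 1\<close>.
\<close>

lemma conn_eta_cases:
  assumes fsc: "finite_simplicial_complex V X" and fin: "conn_eta X \<noteq> \<infinity>"
  obtains m where "conn_eta X = ereal (real m)"
    "reduced_cohomology X (int m - 1) \<noteq> {coboundaries X (int m - 1)}"
proof -
  let ?A = "{i. reduced_cohomology X i \<noteq> {coboundaries X i}}"
  have X: "\<forall>\<sigma>\<in>X. \<forall>\<tau>. \<tau> \<subseteq> \<sigma> \<longrightarrow> \<tau> \<in> X"
    using fsc by (auto simp: finite_simplicial_complex_def)
  have ge: "i \<ge> -1" if "i \<in> ?A" for i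
    using nontrivial_cohomology_degree[OF X, of i] that by simp
  have "?A \<noteq> {}"
  proof
    assume "?A = {}"
    with fin show False by (simp only: conn_eta_def conn_real_def) (simp add: top_ereal_def)
  qed
  then obtain i where i: "i \<in> ?A" by blast
  let ?Q = "\<lambda>n. int n - 1 \<in> ?A"
  define m where "m = (LEAST n. ?Q n)"
  have "?Q (nat (i + 1))" using i ge[OF i] by simp
  then have m: "?Q m" unfolding m_def by (rule LeastI)
  have least: "int m - 1 \<le> j" if "j \<in> ?A" for j
  proof -
    have "?Q (nat (j + 1))" using that ge[OF that] by simp
    then have "m \<le> nat (j + 1)" unfolding m_def by (rule Least_le)
    then show ?thesis using ge[OF that] by linarith
  qed
  have "(INF i\<in>?A. ereal (of_int i)) = ereal (of_int (int m - 1))"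
  proof (rule antisym)
    show "(INF i\<in>?A. ereal (of_int i)) \<le> ereal (of_int (int m - 1))"
      using m by (rule INF_lower)
    show "ereal (of_int (int m - 1)) \<le> (INF i\<in>?A. ereal (of_int i))"
      using least by (intro INF_greatest) (simp add: of_int_le_iff del: of_int_diff)
  qed
  then have "conn_eta X = ereal (of_int (int m - 1)) - 1 + 2"
    by (simp add: conn_eta_def conn_real_def)
  also have "\<dots> = ereal (real m)"
    by (simp add: one_ereal_def numeral_eq_ereal)
  finally show thesis using that m by simp
qed

theorem theorem1p6:
  fixes V :: "'a set" and X :: "'a set set"
  assumes "finite_simplicial_complex V X"
  shows "(if conn_eta X = \<infinity> then \<infinity>
          else ereal (\<Sum>r\<in>missing_dims V X. real r * (real_of_ereal (conn_eta X) gchoose r)))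
         \<ge> domination_Gamma V X"
proof (cases "conn_eta X = \<infinity>")
  case False
  then obtain m where m: "conn_eta X = ereal (real m)"
      "reduced_cohomology X (int m - 1) \<noteq> {coboundaries X (int m - 1)}"
    using conn_eta_cases[OF assms] by blast
  have "domination_Gamma V X \<le> ereal (\<Sum>r\<in>missing_dims V X. real r * real (m choose r))"
    by (rule domination_Gamma_le[OF assms m(2)])
  then show ?thesis by (simp add: m(1) binomial_gbinomial)
qed simp

end
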